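(* Let $\Omega\subset\mathbb{R}^N$ ($N\geq 1$) be open and let $M,\overline{M}$ be a pair of complementary $\Phi$-functions on $\Omega$, both of which are locally integrable and both of which satisfy the $\Delta_2$-condition. Then the Musielak-Orlicz space $L_M(\Omega)$ is reflexive.
   Context: A function $M:\Omega\times[0,\infty)\to[0,\infty]$ is a $\phi$-function if for all $x\in\Omega$ the function $M(x,\cdot)$ is nondecreasing and convex with $M(x,0)=0$, $M(x,s)>0$ for $s>0$, $M(x,s)\to\infty$ as $s\to\infty$, and $M(\cdot,s)$ is measurable for every $s\geq0$. It is a $\Phi$-function if moreover $\lim_{s\to0^+}M(x,s)/s=0$ and $\lim_{s\to+\infty}M(x,s)/s=+\infty$ for all $x\in\Omega$. The complementary function of $M$ (in the sense of Young) is $\overline{M}(x,s)=\sup_{t\geq0}\{st-M(x,t)\}$ for $s\geq0$, $x\in\Omega$. $M$ is locally integrable if $\int_K M(x,c)\,dx<\infty$ for every constant $c>0$ and every compact set $K\subset\Omega$. $M$ satisfies the $\Delta_2$-condition if there exist a constant $k>0$ and a nonnegative $h\in L^1(\Omega)$ such that $M(x,2t)\leq kM(x,t)+h(x)$ for all $t\geq0$ and a.e. $x\in\Omega$. $L_M(\Omega)$ is the Banach space of measurable $u:\Omega\to\mathbb{R}$ (modulo a.e. equality) with $\int_\Omega M(x,|u(x)|/\lambda)\,dx<\infty$ for some $\lambda>0$, with the Luxemburg norm $\|u\|_{L_M(\Omega)}=\inf\{\lambda>0:\int_\Omega M(x,|u(x)|/\lambda)\,dx\leq1\}$. *)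

theory Defs
  imports "HOL-Analysis.Analysis" "HOL-Algebra.Module"
begin

section \<open>Normed spaces with explicit carrier, duals and reflexivity\<close>

text \<open>
  The space below depends on the parameters \<open>\<Omega>\<close> and \<open>M\<close>, so it cannot be a type of class
  \<open>real_normed_vector\<close>. Normed spaces are therefore modules of HOL-Algebra over the ring of reals,
  extended by a norm. The ring multiplication and unit, which the record type inherits,
  have no meaning for a module and are left undefined.
\<close>

definition real_ring :: "real ring" where
  "real_ring = \<lparr>carrier = UNIV, mult = (*), one = 1, zero = 0, add = (+)\<rparr>"

record 'a normed_module = "(real, 'a) module" +
  vnorm :: "'a \<Rightarrow> real"

definition normed_space :: "'a normed_module \<Rightarrow> bool" where
  "normed_space X \<longleftrightarrow>
     module real_ring X \<and>
     (\<forall>x\<in>carrier X. 0 \<le> vnorm X x) \<and>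
     (\<forall>x\<in>carrier X. vnorm X x = 0 \<longleftrightarrow> x = \<zero>\<^bsub>X\<^esub>) \<and>
     (\<forall>x\<in>carrier X. \<forall>a. vnorm X (a \<odot>\<^bsub>X\<^esub> x) = \<bar>a\<bar> * vnorm X x) \<and>
     (\<forall>x\<in>carrier X. \<forall>y\<in>carrier X. vnorm X (x \<oplus>\<^bsub>X\<^esub> y) \<le> vnorm X x + vnorm X y)"

text \<open>
  Functionals are \<open>extensional\<close> (undefined off the carrier), so that equality of functionals
  is equality on the carrier.
\<close>

definition bounded_functionals :: "'a normed_module \<Rightarrow> ('a \<Rightarrow> real) set" where
  "bounded_functionals X = {f \<in> extensional (carrier X).
     (\<forall>x\<in>carrier X. \<forall>y\<in>carrier X. f (x \<oplus>\<^bsub>X\<^esub> y) = f x + f y) \<and>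
     (\<forall>a. \<forall>x\<in>carrier X. f (a \<odot>\<^bsub>X\<^esub> x) = a * f x) \<and>
     (\<exists>C. \<forall>x\<in>carrier X. \<bar>f x\<bar> \<le> C * vnorm X x)}"

definition dual_space :: "'a normed_module \<Rightarrow> ('a \<Rightarrow> real) normed_module" where
  "dual_space X =
     \<lparr>carrier = bounded_functionals X, mult = undefined, one = undefined,
      zero = (\<lambda>x\<in>carrier X. 0),
      add = (\<lambda>f g. \<lambda>x\<in>carrier X. f x + g x),
      smult = (\<lambda>a f. \<lambda>x\<in>carrier X. a * f x),
      vnorm = (\<lambda>f. SUP x\<in>{x \<in> carrier X. vnorm X x \<le> 1}. \<bar>f x\<bar>)\<rparr>"

definition canonical_embedding :: "'a normed_module \<Rightarrow> 'a \<Rightarrow> ('a \<Rightarrow> real) \<Rightarrow> real" where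
  "canonical_embedding X x = (\<lambda>f\<in>carrier (dual_space X). f x)"

definition reflexive_space :: "'a normed_module \<Rightarrow> bool" where
  "reflexive_space X \<longleftrightarrow>
     normed_space X \<and>
     canonical_embedding X ` carrier X = carrier (dual_space (dual_space X))"

section \<open>Musielak-Orlicz functions\<close>

text \<open>
  A function \<open>\<Omega> \<times> [0,\<infinity>) \<rightarrow> [0,\<infinity>]\<close> is given by a total curried function of which only the values
  at \<open>x \<in> \<Omega>\<close> and \<open>s \<ge> 0\<close> are relevant. Measurability on \<open>\<Omega>\<close> is Lebesgue measurability.
\<close>

definition phi_function :: "(real ^ 'n) set \<Rightarrow> (real ^ 'n \<Rightarrow> real \<Rightarrow> ennreal) \<Rightarrow> bool" where
  "phi_function \<Omega> M \<longleftrightarrow>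
     (\<forall>x\<in>\<Omega>.
        mono_on {0..} (M x) \<and>
        (\<forall>s\<ge>0. \<forall>t\<ge>0. \<forall>a\<in>{0..1}.
           M x ((1 - a) * s + a * t) \<le> ennreal (1 - a) * M x s + ennreal a * M x t) \<and>
        M x 0 = 0 \<and>
        (\<forall>s>0. 0 < M x s) \<and>
        (M x \<longlongrightarrow> \<infinity>) at_top) \<and>
     (\<forall>s\<ge>0. (\<lambda>x. M x s) \<in> borel_measurable (lebesgue_on \<Omega>))"

definition Phi_function :: "(real ^ 'n) set \<Rightarrow> (real ^ 'n \<Rightarrow> real \<Rightarrow> ennreal) \<Rightarrow> bool" where
  "Phi_function \<Omega> M \<longleftrightarrow>
     phi_function \<Omega> M \<and>
     (\<forall>x\<in>\<Omega>. ((\<lambda>s. M x s / ennreal s) \<longlongrightarrow> 0) (at_right 0) \<and>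
             ((\<lambda>s. M x s / ennreal s) \<longlongrightarrow> \<infinity>) at_top)"

text \<open>
  The supremum is taken in the extended reals, where \<open>s * t - M x t\<close> may be negative or \<open>-\<infinity>\<close>;
  it is nonnegative if \<open>M x 0 = 0\<close>, so that the conversion to \<open>ennreal\<close> then loses nothing.
\<close>

definition complementary :: "(real ^ 'n \<Rightarrow> real \<Rightarrow> ennreal) \<Rightarrow> real ^ 'n \<Rightarrow> real \<Rightarrow> ennreal" where
  "complementary M x s = e2ennreal (SUP t\<in>{0..}. ereal (s * t) - enn2ereal (M x t))"

definition locally_integrable :: "(real ^ 'n) set \<Rightarrow> (real ^ 'n \<Rightarrow> real \<Rightarrow> ennreal) \<Rightarrow> bool" where
  "locally_integrable \<Omega> M \<longleftrightarrow>
     (\<forall>c>0. \<forall>K. compact K \<and> K \<subseteq> \<Omega> \<longrightarrow> (\<integral>\<^sup>+x. M x c \<partial>lebesgue_on K) < \<infinity>)"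

definition Delta2 :: "(real ^ 'n) set \<Rightarrow> (real ^ 'n \<Rightarrow> real \<Rightarrow> ennreal) \<Rightarrow> bool" where
  "Delta2 \<Omega> M \<longleftrightarrow>
     (\<exists>k>0. \<exists>h. integrable (lebesgue_on \<Omega>) h \<and> (\<forall>x\<in>\<Omega>. 0 \<le> h x) \<and>
        (AE x in lebesgue_on \<Omega>. \<forall>t\<ge>0. M x (2 * t) \<le> ennreal k * M x t + ennreal (h x)))"

section \<open>The Musielak-Orlicz space\<close>

definition modular ::
  "(real ^ 'n) set \<Rightarrow> (real ^ 'n \<Rightarrow> real \<Rightarrow> ennreal) \<Rightarrow> (real ^ 'n \<Rightarrow> real) \<Rightarrow> real \<Rightarrow> ennreal" where
  "modular \<Omega> M u l = (\<integral>\<^sup>+x. M x (\<bar>u x\<bar> / l) \<partial>lebesgue_on \<Omega>)"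

definition MO_functions ::
  "(real ^ 'n) set \<Rightarrow> (real ^ 'n \<Rightarrow> real \<Rightarrow> ennreal) \<Rightarrow> (real ^ 'n \<Rightarrow> real) set" where
  "MO_functions \<Omega> M =
     {u \<in> borel_measurable (lebesgue_on \<Omega>). \<exists>l>0. modular \<Omega> M u l < \<infinity>}"

definition luxemburg_norm ::
  "(real ^ 'n) set \<Rightarrow> (real ^ 'n \<Rightarrow> real \<Rightarrow> ennreal) \<Rightarrow> (real ^ 'n \<Rightarrow> real) \<Rightarrow> real" where
  "luxemburg_norm \<Omega> M u = Inf {l. 0 < l \<and> modular \<Omega> M u l \<le> 1}"

text \<open>
  Functions on \<open>\<Omega>\<close> are represented by total functions; the values off \<open>\<Omega>\<close> do not matter because
  \<open>MO_rel\<close> identifies functions that agree almost everywhere on \<open>\<Omega>\<close>.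
\<close>

definition MO_rel ::
  "(real ^ 'n) set \<Rightarrow> (real ^ 'n \<Rightarrow> real \<Rightarrow> ennreal) \<Rightarrow>
   ((real ^ 'n \<Rightarrow> real) \<times> (real ^ 'n \<Rightarrow> real)) set" where
  "MO_rel \<Omega> M = {(u, v). u \<in> MO_functions \<Omega> M \<and> v \<in> MO_functions \<Omega> M \<and>
     (AE x in lebesgue_on \<Omega>. u x = v x)}"

definition MO_space ::
  "(real ^ 'n) set \<Rightarrow> (real ^ 'n \<Rightarrow> real \<Rightarrow> ennreal) \<Rightarrow>
   (real ^ 'n \<Rightarrow> real) set normed_module" where
  "MO_space \<Omega> M =
     \<lparr>carrier = MO_functions \<Omega> M // MO_rel \<Omega> M, mult = undefined, one = undefined,
      zero = MO_rel \<Omega> M `` {\<lambda>x. 0},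
      add = (\<lambda>U V. \<Union>u\<in>U. \<Union>v\<in>V. MO_rel \<Omega> M `` {\<lambda>x. u x + v x}),
      smult = (\<lambda>a U. \<Union>u\<in>U. MO_rel \<Omega> M `` {\<lambda>x. a * u x}),
      vnorm = (\<lambda>U. the_elem (luxemburg_norm \<Omega> M ` U))\<rparr>"

end

theory Submission
  imports Defs
begin

text \<open>
  Every bounded functional on \<open>L\<^sub>M\<close> is integration against a function of the space of the
  complementary function: for a strictly positive \<open>w\<close> in \<open>L\<^sub>M\<close> the set function \<open>A \<mapsto> F (w 1\<^sub>A)\<close> is a
  finite signed measure, because Delta2 makes the norm order continuous, and its Radon-Nikodym
  density divided by \<open>w\<close> represents \<open>F\<close>. Young duality is symmetric, so the same representation
  holds for functionals on the complementary space. A functional \<open>T\<close> on the dual therefore yields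
  the functional \<open>v \<mapsto> T (\<integral> \<cdot> v)\<close>, which is represented by some \<open>u\<close>, and \<open>T\<close> is evaluation at \<open>u\<close>.
\<close>

section \<open>Integrands satisfying Delta2\<close>

text \<open>Indicators of sets of finite measure need not lie in \<open>L\<close>; multiplying by
  \<open>w\<close> turns every bounded measurable function into an element of the space, and the
  density is found by testing \<open>F\<close> on these products only. That the density divided by
  \<open>w\<close> lies in the complementary space is the hard point: its modular is recovered as a
  limit of integrals of \<open>s * t - \<Phi> x s\<close>, which needs a measurable choice of nearly
  optimal \<open>s\<close>. The complementary pair is described by conditions without suprema,
  symmetric in the two functions, so that one representation theorem serves both spaces. The price
  is that the double conjugate must give back the original function, and that all pointwise
  conditions must hold everywhere with real values, whereas Delta2 holds only almost everywhere and
  the given functions may be infinite. Norms are controlled only up to the factor 2 of Hoelder's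
  inequality. This suffices, because reflexivity asks which functionals occur and not for their
  norms.\<close>

locale Delta2_integrand = sigma_finite_measure \<mu> for \<mu> :: "'a measure" +
  fixes \<Phi> :: "'a \<Rightarrow> real \<Rightarrow> real"
  assumes measurable_\<Phi>: "0 \<le> s \<Longrightarrow> (\<lambda>x. \<Phi> x s) \<in> borel_measurable \<mu>"
    and convex_\<Phi>: "x \<in> space \<mu> \<Longrightarrow> convex_on {0..} (\<Phi> x)"
    and \<Phi>_zero: "x \<in> space \<mu> \<Longrightarrow> \<Phi> x 0 = 0"
    and \<Phi>_pos: "x \<in> space \<mu> \<Longrightarrow> 0 < s \<Longrightarrow> 0 < \<Phi> x s"
    and Delta2_\<Phi>: "\<exists>k\<ge>0. \<exists>h. integrable \<mu> h \<and>
      (\<forall>x\<in>space \<mu>. \<forall>s\<ge>0. \<Phi> x (2 * s) \<le> k * \<Phi> x s + h x)"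
begin

section \<open>Pointwise properties of the integrand\<close>

lemma \<Phi>_nonneg: "x \<in> space \<mu> \<Longrightarrow> 0 \<le> s \<Longrightarrow> 0 \<le> \<Phi> x s"
  using \<Phi>_zero[of x] \<Phi>_pos[of x s] by (cases "s = 0") auto

lemma \<Phi>_convex:
  assumes "x \<in> space \<mu>" "0 \<le> s" "0 \<le> t" "0 \<le> a" "0 \<le> b" "a + b = 1"
  shows "\<Phi> x (a * s + b * t) \<le> a * \<Phi> x s + b * \<Phi> x t"
  using convex_\<Phi>[OF assms(1)] assms unfolding convex_on_def by auto

lemma \<Phi>_shrink:
  assumes "x \<in> space \<mu>" "0 \<le> s" "0 \<le> c" "c \<le> 1"
  shows "\<Phi> x (c * s) \<le> c * \<Phi> x s"
  using \<Phi>_convex[of x s 0 c "1 - c"] \<Phi>_zero[of x] assms by auto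

lemma \<Phi>_mono:
  assumes "x \<in> space \<mu>" "0 \<le> s" "s \<le> t"
  shows "\<Phi> x s \<le> \<Phi> x t"
proof (cases "t = 0")
  case False
  then have "\<Phi> x (s / t * t) \<le> s / t * \<Phi> x t"
    using assms by (intro \<Phi>_shrink) auto
  also have "\<dots> \<le> 1 * \<Phi> x t"
    using assms \<Phi>_nonneg[of x t] by (intro mult_right_mono) (auto simp: divide_le_eq)
  finally show ?thesis using False by simp
qed (use assms in auto)

text \<open>Convexity yields continuity only on the open half-line; at 0 the function is squeezed
  between 0 and the chord \<open>t * \<Phi> x 1\<close>.\<close>

lemma continuous_\<Phi>:
  assumes x: "x \<in> space \<mu>"
  shows "continuous_on {0..} (\<Phi> x)"
  unfolding continuous_on_def
proof
  fix s :: real assume "s \<in> {0..}"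
  then consider "s = 0" | "0 < s" by force
  then show "(\<Phi> x \<longlongrightarrow> \<Phi> x s) (at s within {0..})"
  proof cases
    case 1
    have "((\<lambda>t. t * \<Phi> x 1) \<longlongrightarrow> 0 * \<Phi> x 1) (at 0 within {0..})"
      by (intro tendsto_intros)
    moreover have "\<forall>\<^sub>F t in at 0 within {0..}. norm (\<Phi> x t) \<le> t * \<Phi> x 1"
      unfolding eventually_at
      using \<Phi>_shrink[OF x, of 1] \<Phi>_nonneg[OF x]
      by (intro exI[of _ 1]) (auto simp: dist_real_def)
    ultimately show ?thesis
      using 1 \<Phi>_zero[OF x] by (auto intro: Lim_null_comparison)
  next
    case 2
    have "convex_on {0<..} (\<Phi> x)"
      by (rule convex_on_subset[OF convex_\<Phi>[OF x]]) auto
    then have "continuous_on {0<..} (\<Phi> x)"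
      by (intro convex_on_continuous) auto
    then have "isCont (\<Phi> x) s"
      using 2 by (simp add: continuous_on_eq_continuous_at)
    then show ?thesis
      using continuous_at_imp_continuous_at_within continuous_within by blast
  qed
qed

lemma tendsto_\<Phi>:
  assumes x: "x \<in> space \<mu>" and "(f \<longlongrightarrow> s) F" "0 \<le> s" "\<And>i. 0 \<le> f i"
  shows "((\<lambda>i. \<Phi> x (f i)) \<longlongrightarrow> \<Phi> x s) F"
  using continuous_on_tendsto_compose[OF continuous_\<Phi>[OF x] assms(2)] assms by auto

text \<open>Measurability in \<open>x\<close> is known only for each fixed \<open>s\<close>.
  Rounding \<open>\<bar>u x\<bar>\<close> down to a multiple of \<open>1 / 2 ^ n\<close> leaves
  countably many values of \<open>s\<close>, and continuity in \<open>s\<close> carries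
  measurability to the limit.\<close>

lemma borel_measurable_\<Phi>_abs:
  assumes u: "u \<in> borel_measurable \<mu>"
  shows "(\<lambda>x. \<Phi> x \<bar>u x\<bar>) \<in> borel_measurable \<mu>"
proof (rule borel_measurable_LIMSEQ_real)
  define d where "d n x = real (nat \<lfloor>2 ^ n * \<bar>u x\<bar>\<rfloor>) / 2 ^ n" for n :: nat and x
  show "(\<lambda>x. \<Phi> x (d n x)) \<in> borel_measurable \<mu>" for n
    unfolding d_def
    by (rule measurable_compose_countable[where f = "\<lambda>i x. \<Phi> x (real i / 2 ^ n)"])
      (use u in \<open>auto intro!: measurable_\<Phi>\<close>)
  fix x assume x: "x \<in> space \<mu>"
  have *: "\<bar>d n x - \<bar>u x\<bar>\<bar> \<le> (1 / 2) ^ n" for n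
  proof -
    have "d n x = real_of_int \<lfloor>2 ^ n * \<bar>u x\<bar>\<rfloor> / 2 ^ n"
      unfolding d_def by simp
    moreover have "\<bar>real_of_int \<lfloor>2 ^ n * \<bar>u x\<bar>\<rfloor> - 2 ^ n * \<bar>u x\<bar>\<bar> \<le> 1"
      by linarith
    ultimately have "\<bar>d n x * 2 ^ n - \<bar>u x\<bar> * 2 ^ n\<bar> \<le> 1"
      by (simp add: mult.commute)
    then have "\<bar>d n x - \<bar>u x\<bar>\<bar> * 2 ^ n \<le> 1"
      by (simp add: left_diff_distrib[symmetric] abs_mult)
    then show ?thesis
      by (simp add: power_one_over pos_le_divide_eq)
  qed
  have "(\<lambda>n. d n x - \<bar>u x\<bar>) \<longlonglongrightarrow> 0"
    by (rule Lim_null_comparison[of _ "\<lambda>n. (1 / 2) ^ n"])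
      (use * in \<open>auto intro!: LIMSEQ_power_zero\<close>)
  then have "(\<lambda>n. d n x) \<longlonglongrightarrow> \<bar>u x\<bar>"
    by (simp add: LIM_zero_iff)
  then show "(\<lambda>n. \<Phi> x (d n x)) \<longlonglongrightarrow> \<Phi> x \<bar>u x\<bar>"
    by (intro tendsto_\<Phi> x) (auto simp: d_def)
qed

section \<open>The modular and the Luxemburg norm\<close>

text \<open>Only the modular at scale 1 is asked to be finite; by \<open>L_scale\<close>, which
  rests on Delta2, finiteness at any positive scale amounts to the same.\<close>

definition L :: "('a \<Rightarrow> real) set" where
  "L = {u \<in> borel_measurable \<mu>. integrable \<mu> (\<lambda>x. \<Phi> x \<bar>u x\<bar>)}"

text \<open>The Bochner integral of a nonintegrable function is 0, so a small value means something
  only for \<open>u \<in> L\<close>; hence the membership hypotheses below.\<close>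

definition modu :: "('a \<Rightarrow> real) \<Rightarrow> real" where
  "modu u = (\<integral>x. \<Phi> x \<bar>u x\<bar> \<partial>\<mu>)"

definition lux :: "('a \<Rightarrow> real) \<Rightarrow> real" where
  "lux u = Inf {l. 0 < l \<and> modu (\<lambda>x. u x / l) \<le> 1}"

lemma L_measurable: "u \<in> L \<Longrightarrow> u \<in> borel_measurable \<mu>"
  by (simp add: L_def)

lemma L_integrable: "u \<in> L \<Longrightarrow> integrable \<mu> (\<lambda>x. \<Phi> x \<bar>u x\<bar>)"
  by (simp add: L_def)

lemma L_dominated:
  assumes u: "u \<in> L" and v: "v \<in> borel_measurable \<mu>" and le: "AE x in \<mu>. \<bar>v x\<bar> \<le> \<bar>u x\<bar>"
  shows "v \<in> L" "modu v \<le> modu u"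
proof -
  have le': "AE x in \<mu>. \<Phi> x \<bar>v x\<bar> \<le> \<Phi> x \<bar>u x\<bar>"
    using le AE_space by eventually_elim (auto intro: \<Phi>_mono)
  moreover have "AE x in \<mu>. norm (\<Phi> x \<bar>v x\<bar>) \<le> norm (\<Phi> x \<bar>u x\<bar>)"
    using le' AE_space by eventually_elim (auto simp: \<Phi>_nonneg)
  then have "integrable \<mu> (\<lambda>x. \<Phi> x \<bar>v x\<bar>)"
    by (rule Bochner_Integration.integrable_bound[OF L_integrable[OF u] borel_measurable_\<Phi>_abs[OF v]])
  ultimately show "v \<in> L" "modu v \<le> modu u"
    using u v unfolding L_def modu_def by (auto intro!: integral_mono_AE)
qed

lemma modu_nonneg: "0 \<le> modu u"
  unfolding modu_def by (rule integral_nonneg_AE) (use \<Phi>_nonneg in auto)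

lemma modu_cong: "AE x in \<mu>. u x = v x \<Longrightarrow> u \<in> L \<Longrightarrow> v \<in> L \<Longrightarrow> modu u = modu v"
  unfolding modu_def
  by (rule integral_cong_AE) (auto simp: borel_measurable_\<Phi>_abs L_measurable)

lemma L_double:
  assumes u: "u \<in> L"
  shows "(\<lambda>x. 2 * u x) \<in> L"
proof -
  obtain k h where k: "k \<ge> 0" "integrable \<mu> h"
    "\<And>x s. x \<in> space \<mu> \<Longrightarrow> 0 \<le> s \<Longrightarrow> \<Phi> x (2 * s) \<le> k * \<Phi> x s + h x"
    using Delta2_\<Phi> by blast
  have meas: "(\<lambda>x. 2 * u x) \<in> borel_measurable \<mu>"
    using L_measurable[OF u] by simp
  have "integrable \<mu> (\<lambda>x. \<Phi> x \<bar>2 * u x\<bar>)"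
  proof (rule Bochner_Integration.integrable_bound)
    show "integrable \<mu> (\<lambda>x. k * \<Phi> x \<bar>u x\<bar> + h x)"
      using L_integrable[OF u] k by auto
    show "(\<lambda>x. \<Phi> x \<bar>2 * u x\<bar>) \<in> borel_measurable \<mu>"
      by (rule borel_measurable_\<Phi>_abs[OF meas])
    show "AE x in \<mu>. norm (\<Phi> x \<bar>2 * u x\<bar>) \<le> norm (k * \<Phi> x \<bar>u x\<bar> + h x)"
    proof (rule AE_I2)
      fix x assume x: "x \<in> space \<mu>"
      show "norm (\<Phi> x \<bar>2 * u x\<bar>) \<le> norm (k * \<Phi> x \<bar>u x\<bar> + h x)"
        using k(3)[OF x, of "\<bar>u x\<bar>"] \<Phi>_nonneg[OF x, of "2 * \<bar>u x\<bar>"] by (simp add: abs_mult)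
    qed
  qed
  then show ?thesis using meas by (simp add: L_def)
qed

text \<open>Repeated doubling reaches a power of two above \<open>\<bar>c\<bar>\<close>, and the
  domination property of \<open>L\<close> covers all smaller factors.\<close>

lemma L_scale:
  assumes u: "u \<in> L"
  shows "(\<lambda>x. c * u x) \<in> L"
proof -
  have pow: "(\<lambda>x. 2 ^ n * u x) \<in> L" for n :: nat
  proof (induction n)
    case (Suc n)
    then show ?case using L_double[OF Suc] by (simp add: mult.assoc)
  qed (use u in simp)
  obtain n where n: "\<bar>c\<bar> < 2 ^ n"
    using real_arch_pow[of 2 "\<bar>c\<bar>"] by auto
  show ?thesis
  proof (rule L_dominated(1)[OF pow[of n]])
    show "AE x in \<mu>. \<bar>c * u x\<bar> \<le> \<bar>2 ^ n * u x\<bar>"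
      using n by (auto simp: abs_mult intro!: mult_right_mono)
  qed (use L_measurable[OF u] in simp)
qed

lemma L_divide: "u \<in> L \<Longrightarrow> (\<lambda>x. u x / c) \<in> L"
  using L_scale[of u "1 / c"] by simp

lemma L_zero: "(\<lambda>x. 0) \<in> L"
proof -
  have "integrable \<mu> (\<lambda>x. \<Phi> x \<bar>0\<bar>) \<longleftrightarrow> integrable \<mu> (\<lambda>x. 0::real)"
    by (rule Bochner_Integration.integrable_cong) (use \<Phi>_zero in auto)
  then show ?thesis
    by (simp add: L_def)
qed

lemma modu_convex:
  assumes u: "u \<in> L" and v: "v \<in> L" and a: "0 \<le> a" "0 \<le> b" "a + b = 1"
  shows "(\<lambda>x. a * u x + b * v x) \<in> L"
    and "modu (\<lambda>x. a * u x + b * v x) \<le> a * modu u + b * modu v"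
proof -
  have meas: "(\<lambda>x. a * u x + b * v x) \<in> borel_measurable \<mu>"
    using L_measurable[OF u] L_measurable[OF v] by simp
  have int: "integrable \<mu> (\<lambda>x. a * \<Phi> x \<bar>u x\<bar> + b * \<Phi> x \<bar>v x\<bar>)"
    using L_integrable[OF u] L_integrable[OF v] by auto
  have le: "\<Phi> x \<bar>a * u x + b * v x\<bar> \<le> a * \<Phi> x \<bar>u x\<bar> + b * \<Phi> x \<bar>v x\<bar>"
    if x: "x \<in> space \<mu>" for x
  proof -
    have "\<bar>a * u x + b * v x\<bar> \<le> a * \<bar>u x\<bar> + b * \<bar>v x\<bar>"
      using abs_triangle_ineq[of "a * u x" "b * v x"] a by (simp add: abs_mult)
    then have "\<Phi> x \<bar>a * u x + b * v x\<bar> \<le> \<Phi> x (a * \<bar>u x\<bar> + b * \<bar>v x\<bar>)"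
      by (intro \<Phi>_mono x) auto
    also have "\<dots> \<le> a * \<Phi> x \<bar>u x\<bar> + b * \<Phi> x \<bar>v x\<bar>"
      using a by (intro \<Phi>_convex x) auto
    finally show ?thesis .
  qed
  have *: "integrable \<mu> (\<lambda>x. \<Phi> x \<bar>a * u x + b * v x\<bar>)"
  proof (rule Bochner_Integration.integrable_bound[OF int borel_measurable_\<Phi>_abs[OF meas]])
    show "AE x in \<mu>. norm (\<Phi> x \<bar>a * u x + b * v x\<bar>) \<le> norm (a * \<Phi> x \<bar>u x\<bar> + b * \<Phi> x \<bar>v x\<bar>)"
    proof (rule AE_I2)
      fix x assume x: "x \<in> space \<mu>"
      show "norm (\<Phi> x \<bar>a * u x + b * v x\<bar>) \<le> norm (a * \<Phi> x \<bar>u x\<bar> + b * \<Phi> x \<bar>v x\<bar>)"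
        using le[OF x] \<Phi>_nonneg[OF x, of "\<bar>a * u x + b * v x\<bar>"] by simp
    qed
  qed
  then show "(\<lambda>x. a * u x + b * v x) \<in> L"
    using meas by (simp add: L_def)
  have "modu (\<lambda>x. a * u x + b * v x) \<le> (\<integral>x. a * \<Phi> x \<bar>u x\<bar> + b * \<Phi> x \<bar>v x\<bar> \<partial>\<mu>)"
    unfolding modu_def by (intro integral_mono * int le)
  also have "\<dots> = a * modu u + b * modu v"
    unfolding modu_def using L_integrable[OF u] L_integrable[OF v] by simp
  finally show "modu (\<lambda>x. a * u x + b * v x) \<le> a * modu u + b * modu v" .
qed

lemma L_add:
  assumes "u \<in> L" "v \<in> L"
  shows "(\<lambda>x. u x + v x) \<in> L"
  using modu_convex(1)[OF L_scale[OF assms(1), of 2] L_scale[OF assms(2), of 2], of "1/2" "1/2"]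
  by simp

lemma modu_zero: "modu (\<lambda>x. 0) = 0"
proof -
  have "modu (\<lambda>x. 0) = (\<integral>x. 0 \<partial>\<mu>)"
    unfolding modu_def by (rule Bochner_Integration.integral_cong) (use \<Phi>_zero in auto)
  then show ?thesis by simp
qed

lemma modu_shrink:
  assumes u: "u \<in> L" and c: "0 \<le> c" "c \<le> 1"
  shows "modu (\<lambda>x. c * u x) \<le> c * modu u"
  using modu_convex(2)[OF u L_zero, of c "1 - c"] c by (simp add: modu_zero)

lemma lux_le: "0 < l \<Longrightarrow> modu (\<lambda>x. u x / l) \<le> 1 \<Longrightarrow> lux u \<le> l"
  unfolding lux_def by (intro cInf_lower) (auto intro!: bdd_belowI[of _ 0])

lemma lux_cong:
  assumes "AE x in \<mu>. u x = v x" "u \<in> L" "v \<in> L"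
  shows "lux u = lux v"
proof -
  have "modu (\<lambda>x. u x / l) = modu (\<lambda>x. v x / l)" for l
    by (rule modu_cong) (use assms in \<open>auto intro: L_divide\<close>)
  then show ?thesis by (simp add: lux_def)
qed

text \<open>By convexity, dividing by \<open>1 + modu u\<close> divides the modular by at least that
  much. So the infimum in \<open>lux\<close> runs over a nonempty set, and
  \<open>lux u \<le> 1 + modu u\<close> follows, the link between norm and modular in the
  representation theorem.\<close>

lemma modu_divide_le_one:
  assumes u: "u \<in> L"
  shows "modu (\<lambda>x. u x / (1 + modu u)) \<le> 1"
proof -
  have "modu (\<lambda>x. 1 / (1 + modu u) * u x) \<le> 1 / (1 + modu u) * modu u"
    using modu_nonneg[of u] by (intro modu_shrink u) (auto simp: divide_le_eq)
  also have "\<dots> \<le> 1"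
    using modu_nonneg[of u] by (simp add: divide_le_eq)
  finally show ?thesis by simp
qed

lemma lux_le_modu: "u \<in> L \<Longrightarrow> lux u \<le> 1 + modu u"
  using modu_nonneg[of u] by (intro lux_le modu_divide_le_one) auto

lemma lux_nonneg: "u \<in> L \<Longrightarrow> 0 \<le> lux u"
  unfolding lux_def using modu_divide_le_one[of u] modu_nonneg[of u]
  by (intro cInf_greatest) (auto intro!: exI[of _ "1 + modu u"])

text \<open>The strict inequality avoids the question whether the infimum is attained; norm
  estimates are proved for every \<open>l\<close> above the norm and then passed to the
  limit.\<close>

lemma modu_le_one:
  assumes u: "u \<in> L" and l: "lux u < l"
  shows "modu (\<lambda>x. u x / l) \<le> 1"
proof -
  have "{l. 0 < l \<and> modu (\<lambda>x. u x / l) \<le> 1} \<noteq> {}"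
    using modu_divide_le_one[OF u] modu_nonneg[of u] by (auto intro!: exI[of _ "1 + modu u"])
  then obtain r where r: "0 < r" "r < l" "modu (\<lambda>x. u x / r) \<le> 1"
    using l cInf_lessD[of "{l. 0 < l \<and> modu (\<lambda>x. u x / l) \<le> 1}" l] unfolding lux_def by blast
  have "modu (\<lambda>x. u x / l) \<le> modu (\<lambda>x. u x / r)"
  proof (rule L_dominated(2)[OF L_divide[OF u]])
    show "AE x in \<mu>. \<bar>u x / l\<bar> \<le> \<bar>u x / r\<bar>"
      using r by (auto intro!: divide_left_mono)
  qed (use L_measurable[OF u] in simp)
  then show ?thesis using r by simp
qed

lemma lux_mono:
  assumes u: "u \<in> L" and v: "v \<in> borel_measurable \<mu>" and le: "AE x in \<mu>. \<bar>v x\<bar> \<le> \<bar>u x\<bar>"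
  shows "lux v \<le> lux u"
proof (rule dense_ge)
  fix l assume l: "lux u < l"
  then have pos: "0 < l" using lux_nonneg[OF u] by simp
  have "modu (\<lambda>x. v x / l) \<le> modu (\<lambda>x. u x / l)"
  proof (rule L_dominated(2)[OF L_divide[OF u]])
    show "AE x in \<mu>. \<bar>v x / l\<bar> \<le> \<bar>u x / l\<bar>"
      using le pos by (auto elim!: AE_mp intro!: divide_right_mono)
  qed (use v in simp)
  then show "lux v \<le> l"
    using modu_le_one[OF u l] pos by (intro lux_le) auto
qed

lemma lux_add:
  assumes u: "u \<in> L" and v: "v \<in> L"
  shows "lux (\<lambda>x. u x + v x) \<le> lux u + lux v"
proof -
  have *: "lux (\<lambda>x. u x + v x) \<le> a + b" if a: "lux u < a" and b: "lux v < b" for a b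
  proof (rule lux_le)
    have pos: "0 < a" "0 < b" using a b lux_nonneg[OF u] lux_nonneg[OF v] by auto
    then show "0 < a + b" by simp
    \<comment> \<open>With these weights \<open>(u + v) / (a + b)\<close> is a convex combination of
      \<open>u / a\<close> and \<open>v / b\<close>.\<close>
    have "modu (\<lambda>x. a / (a + b) * (u x / a) + b / (a + b) * (v x / b)) \<le>
        a / (a + b) * modu (\<lambda>x. u x / a) + b / (a + b) * modu (\<lambda>x. v x / b)"
      using pos by (intro modu_convex L_divide u v) (auto simp: add_divide_distrib[symmetric])
    also have "\<dots> \<le> a / (a + b) * 1 + b / (a + b) * 1"
      using pos modu_le_one[OF u a] modu_le_one[OF v b]
      by (intro add_mono mult_left_mono) auto
    also have "\<dots> = 1" using pos by (simp add: add_divide_distrib[symmetric])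
    finally show "modu (\<lambda>x. (u x + v x) / (a + b)) \<le> 1"
      using pos by (simp add: add_divide_distrib)
  qed
  show ?thesis
  proof (rule field_le_epsilon)
    fix e :: real assume "0 < e"
    then show "lux (\<lambda>x. u x + v x) \<le> lux u + lux v + e"
      using *[of "lux u + e / 2" "lux v + e / 2"] by simp
  qed
qed

lemma lux_scale_le:
  assumes u: "u \<in> L"
  shows "lux (\<lambda>x. c * u x) \<le> \<bar>c\<bar> * lux u"
proof (cases "c = 0")
  case True
  have "lux (\<lambda>x. 0) \<le> e" if "0 < e" for e
    using that by (intro lux_le) (simp_all add: modu_zero)
  then show ?thesis using True by (auto intro: dense_ge)
next
  case False
  have "lux (\<lambda>x. c * u x) / \<bar>c\<bar> \<le> lux u"
  proof (rule dense_ge)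
    fix l assume l: "lux u < l"
    then have pos: "0 < l" using lux_nonneg[OF u] by simp
    have "modu (\<lambda>x. c * u x / (\<bar>c\<bar> * l)) = modu (\<lambda>x. u x / l)"
      unfolding modu_def using False pos by (simp add: abs_mult)
    then have "lux (\<lambda>x. c * u x) \<le> \<bar>c\<bar> * l"
      using modu_le_one[OF u l] pos False by (intro lux_le) auto
    then show "lux (\<lambda>x. c * u x) / \<bar>c\<bar> \<le> l"
      using False by (simp add: divide_le_eq mult.commute)
  qed
  then show ?thesis using False by (simp add: divide_le_eq mult.commute)
qed

lemma lux_scale:
  assumes u: "u \<in> L"
  shows "lux (\<lambda>x. c * u x) = \<bar>c\<bar> * lux u"
proof (cases "c = 0")
  case True
  then show ?thesis
    using lux_scale_le[OF u, of 0] lux_nonneg[OF L_zero] by auto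
next
  case False
  have "lux (\<lambda>x. 1 / c * (c * u x)) \<le> \<bar>1 / c\<bar> * lux (\<lambda>x. c * u x)"
    by (intro lux_scale_le L_scale u)
  then have "\<bar>c\<bar> * lux u \<le> lux (\<lambda>x. c * u x)"
    using False by (simp add: field_simps)
  then show ?thesis using lux_scale_le[OF u, of c] by simp
qed

text \<open>If the norm vanishes, \<open>u / e\<close> has modular at most 1 for all small
  \<open>e\<close>, so convexity gives \<open>modu u \<le> e\<close>. A vanishing modular forces
  \<open>u = 0\<close> almost everywhere because \<open>\<Phi>\<close> is strictly positive off
  0.\<close>

lemma lux_eq_zero_iff:
  assumes u: "u \<in> L"
  shows "lux u = 0 \<longleftrightarrow> (AE x in \<mu>. u x = 0)"
proof
  assume z: "lux u = 0"
  have "modu u \<le> e" if e: "0 < e" "e < 1" for e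
  proof -
    have "modu (\<lambda>x. e * (u x / e)) \<le> e * modu (\<lambda>x. u x / e)"
      using e by (intro modu_shrink L_divide u) auto
    also have "\<dots> \<le> e * 1"
      using modu_le_one[OF u, of e] z e by (intro mult_left_mono) auto
    finally show ?thesis using e by simp
  qed
  then have "modu u \<le> 0"
    by (intro dense_ge_bounded[of 0 1]) auto
  then have "(\<integral>x. \<Phi> x \<bar>u x\<bar> \<partial>\<mu>) = 0"
    using modu_nonneg[of u] by (simp add: modu_def)
  moreover have "AE x in \<mu>. 0 \<le> \<Phi> x \<bar>u x\<bar>"
    using \<Phi>_nonneg by auto
  ultimately have "AE x in \<mu>. \<Phi> x \<bar>u x\<bar> = 0"
    using integral_nonneg_eq_0_iff_AE[OF L_integrable[OF u]] by blast
  then show "AE x in \<mu>. u x = 0"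
    using AE_space
  proof eventually_elim
    case (elim x)
    then show ?case
      using \<Phi>_pos[OF elim(2), of "\<bar>u x\<bar>"] by (cases "u x = 0") auto
  qed
next
  assume "AE x in \<mu>. u x = 0"
  then have "lux u = lux (\<lambda>x. 0 * u x)"
    by (intro lux_cong) (auto simp: u L_zero)
  then show "lux u = 0"
    using lux_scale[OF u, of 0] by simp
qed

text \<open>Delta2 makes the norm order continuous: all the functions \<open>\<Phi> x (\<bar>u x\<bar> / e)\<close> are integrable majorants.\<close>

lemma lux_order_continuous:
  assumes u: "u \<in> L" and v: "\<And>n. v n \<in> borel_measurable \<mu>"
    and le: "\<And>n. AE x in \<mu>. \<bar>v n x\<bar> \<le> \<bar>u x\<bar>"
    and lim: "AE x in \<mu>. (\<lambda>n. v n x) \<longlonglongrightarrow> 0"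
  shows "(\<lambda>n. lux (v n)) \<longlonglongrightarrow> 0"
proof (rule LIMSEQ_I)
  fix e :: real assume e: "0 < e"
  define r where "r = e / 2"
  have r: "0 < r" using e by (simp add: r_def)
  have vL: "v n \<in> L" for n
    using L_dominated(1)[OF u v le] .
  have "(\<lambda>n. \<integral>x. \<Phi> x \<bar>v n x / r\<bar> \<partial>\<mu>) \<longlonglongrightarrow> (\<integral>x. 0 \<partial>\<mu>)"
  proof (rule integral_dominated_convergence)
    show "integrable \<mu> (\<lambda>x. \<Phi> x \<bar>u x / r\<bar>)"
      by (rule L_integrable[OF L_divide[OF u]])
    show "(\<lambda>x. \<Phi> x \<bar>v n x / r\<bar>) \<in> borel_measurable \<mu>" for n
      using v by (intro borel_measurable_\<Phi>_abs) simp
    show "AE x in \<mu>. (\<lambda>n. \<Phi> x \<bar>v n x / r\<bar>) \<longlonglongrightarrow> 0"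
      using lim AE_space
    proof eventually_elim
      case (elim x)
      have "(\<lambda>n. \<bar>v n x / r\<bar>) \<longlonglongrightarrow> \<bar>0 / r\<bar>"
        using r by (intro tendsto_intros elim) auto
      then have "(\<lambda>n. \<Phi> x \<bar>v n x / r\<bar>) \<longlonglongrightarrow> \<Phi> x 0"
        by (intro tendsto_\<Phi>) (use elim in auto)
      then show ?case using \<Phi>_zero[OF elim(2)] by simp
    qed
    show "AE x in \<mu>. norm (\<Phi> x \<bar>v n x / r\<bar>) \<le> \<Phi> x \<bar>u x / r\<bar>" for n
      using le[of n] AE_space
    proof eventually_elim
      case (elim x)
      have "\<bar>v n x / r\<bar> \<le> \<bar>u x / r\<bar>"
        using elim(1) r by (auto intro: divide_right_mono)
      then show ?case
        using \<Phi>_mono[OF elim(2), of "\<bar>v n x / r\<bar>" "\<bar>u x / r\<bar>"] \<Phi>_nonneg[OF elim(2), of "\<bar>v n x / r\<bar>"]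
        by simp
    qed
  qed simp
  then have "(\<lambda>n. modu (\<lambda>x. v n x / r)) \<longlonglongrightarrow> 0"
    by (simp add: modu_def)
  then have "\<forall>\<^sub>F n in sequentially. modu (\<lambda>x. v n x / r) < 1"
    by (rule order_tendstoD) simp
  then obtain N where N: "\<And>n. n \<ge> N \<Longrightarrow> modu (\<lambda>x. v n x / r) < 1"
    by (auto simp: eventually_sequentially)
  have "norm (lux (v n) - 0) < e" if "n \<ge> N" for n
    using lux_le[OF r, of "v n"] N[OF that] lux_nonneg[OF vL[of n]] e by (simp add: r_def)
  then show "\<exists>no. \<forall>n\<ge>no. norm (lux (v n) - 0) < e" by blast
qed

text \<open>Since \<open>\<Phi> x 1 < \<infinity>\<close>, the function \<open>min 1 (g x / \<Phi> x 1)\<close> works for every positive integrable \<open>g\<close>.\<close>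

lemma obtain_positive_in_L:
  obtains w where "w \<in> L" "\<And>x. x \<in> space \<mu> \<Longrightarrow> 0 < w x"
proof -
  obtain g :: "'a \<Rightarrow> real" where g: "g \<in> borel_measurable \<mu>" "\<And>x. 0 < g x" "integrable \<mu> g"
    using obtain_positive_integrable_function by metis
  define w where "w x = min 1 (g x / \<Phi> x 1)" for x
  have pos: "0 < w x" if "x \<in> space \<mu>" for x
    using g \<Phi>_pos[OF that, of 1] by (auto simp: w_def)
  have meas: "w \<in> borel_measurable \<mu>"
    unfolding w_def using g measurable_\<Phi>[of 1] by simp
  have "integrable \<mu> (\<lambda>x. \<Phi> x \<bar>w x\<bar>)"
  proof (rule Bochner_Integration.integrable_bound[OF g(3) borel_measurable_\<Phi>_abs[OF meas]])
    show "AE x in \<mu>. norm (\<Phi> x \<bar>w x\<bar>) \<le> norm (g x)"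
    proof (rule AE_I2)
      fix x assume x: "x \<in> space \<mu>"
      \<comment> \<open>The cap at 1 in \<open>w\<close> is what lets convexity apply here.\<close>
      have "\<Phi> x (w x * 1) \<le> w x * \<Phi> x 1"
        using pos[OF x] by (intro \<Phi>_shrink x) (auto simp: w_def)
      also have "\<dots> \<le> g x / \<Phi> x 1 * \<Phi> x 1"
        using \<Phi>_pos[OF x, of 1] by (intro mult_right_mono) (auto simp: w_def)
      also have "\<dots> = g x" using \<Phi>_pos[OF x, of 1] by simp
      finally show "norm (\<Phi> x \<bar>w x\<bar>) \<le> norm (g x)"
        using pos[OF x] \<Phi>_nonneg[OF x, of "w x"] g(2)[of x] by simp
    qed
  qed
  then show ?thesis using that[of w] meas pos by (simp add: L_def)
qed

end

section \<open>The Radon-Nikodym density of a bounded functional\<close>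

text \<open>A finite, finitely additive set function is countably additive once it is continuous
  along sets decreasing to the empty set, and order continuity of the norm delivers exactly that.
  Finite total mass makes the extended-valued density finite almost everywhere, so it may be
  replaced by an integrable real function.\<close>

lemma (in sigma_finite_measure) Radon_Nikodym_real:
  fixes \<nu> :: "'a set \<Rightarrow> real"
  assumes nonneg: "\<And>A. A \<in> sets M \<Longrightarrow> 0 \<le> \<nu> A"
    and add: "\<And>A B. A \<in> sets M \<Longrightarrow> B \<in> sets M \<Longrightarrow> A \<inter> B = {} \<Longrightarrow> \<nu> (A \<union> B) = \<nu> A + \<nu> B"
    and cont: "\<And>A. range A \<subseteq> sets M \<Longrightarrow> decseq A \<Longrightarrow> (\<Inter>i. A i) = {} \<Longrightarrow> (\<lambda>i. \<nu> (A i)) \<longlonglongrightarrow> 0"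
    and null: "\<And>A. A \<in> null_sets M \<Longrightarrow> \<nu> A = 0"
  shows "\<exists>g. integrable M g \<and> (\<forall>A\<in>sets M. (\<integral>x. g x * indicator A x \<partial>M) = \<nu> A)"
proof -
  define N where "N = measure_of (space M) (sets M) (\<lambda>A. ennreal (\<nu> A))"
  have sets_N: "sets N = sets M" by (simp add: N_def)
  have pos: "positive (sets M) (\<lambda>A. ennreal (\<nu> A))"
    using null[of "{}"] by (auto simp: positive_def)
  have "countably_additive (sets M) (\<lambda>A. ennreal (\<nu> A))"
  proof (rule sets.empty_continuous_imp_countably_additive[OF pos])
    show "additive (sets M) (\<lambda>A. ennreal (\<nu> A))"
      using add nonneg by (auto simp: additive_def)
    show "(\<lambda>i. ennreal (\<nu> (A i))) \<longlonglongrightarrow> 0"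
      if "range A \<subseteq> sets M" "decseq A" "(\<Inter>i. A i) = {}" for A :: "nat \<Rightarrow> 'a set"
      using tendsto_ennrealI[OF cont[OF that]] by simp
  qed simp
  then have N: "emeasure N A = ennreal (\<nu> A)" if "A \<in> sets M" for A
    using that pos unfolding N_def
    by (intro emeasure_measure_of_sigma sets.sigma_algebra_axioms) auto
  have "absolutely_continuous M N"
    using N null sets_N unfolding absolutely_continuous_def
    by (intro subsetI null_setsI) (simp_all add: null_setsD2)
  then obtain f where f: "f \<in> borel_measurable M" "density M f = N"
    using Radon_Nikodym[OF _ sets_N] by blast
  have f_int: "(\<integral>\<^sup>+x. f x * indicator A x \<partial>M) = ennreal (\<nu> A)" if "A \<in> sets M" for A
    using emeasure_density[OF f(1) that] N[OF that] f(2) by simp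
  have "(\<integral>\<^sup>+x. f x \<partial>M) = (\<integral>\<^sup>+x. f x * indicator (space M) x \<partial>M)"
    by (rule nn_integral_cong) simp
  then have "(\<integral>\<^sup>+x. f x \<partial>M) \<noteq> \<infinity>"
    using f_int[of "space M"] by simp
  then have fin: "AE x in M. f x \<noteq> \<infinity>"
    by (rule nn_integral_PInf_AE[OF f(1)])
  define g where "g x = enn2real (f x)" for x
  have g_meas: "g \<in> borel_measurable M"
    unfolding g_def using f(1) by simp
  have g_int: "(\<integral>\<^sup>+x. ennreal (g x * indicator A x) \<partial>M) = ennreal (\<nu> A)" if "A \<in> sets M" for A
  proof -
    have "(\<integral>\<^sup>+x. ennreal (g x * indicator A x) \<partial>M) = (\<integral>\<^sup>+x. f x * indicator A x \<partial>M)"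
      by (rule nn_integral_cong_AE) (use fin in \<open>eventually_elim, auto simp: g_def indicator_def less_top\<close>)
    then show ?thesis using f_int[OF that] by simp
  qed
  have *: "has_bochner_integral M (\<lambda>x. g x * indicator A x) (\<nu> A)" if "A \<in> sets M" for A
  proof (rule has_bochner_integral_nn_integral)
    show "(\<lambda>x. g x * indicator A x) \<in> borel_measurable M"
      using g_meas that by simp
  qed (use g_int[OF that] nonneg[OF that] in \<open>auto simp: g_def\<close>)
  have "integrable M (\<lambda>x. g x * indicator (space M) x)"
    using *[of "space M"] by (auto simp: has_bochner_integral_iff)
  moreover have "integrable M (\<lambda>x. g x * indicator (space M) x) \<longleftrightarrow> integrable M g"
    by (rule Bochner_Integration.integrable_cong) auto
  ultimately show ?thesis
    using * by (auto simp: has_bochner_integral_iff)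
qed

text \<open>Functionals act on functions, not on classes. Functions of \<open>L\<close> that agree
  almost everywhere still get the same value, since \<open>F_bound\<close> applies to their
  difference, which has norm zero.\<close>

locale bounded_functional = Delta2_integrand \<mu> \<Phi> for \<mu> :: "'a measure" and \<Phi> +
  fixes F :: "('a \<Rightarrow> real) \<Rightarrow> real" and C :: real and w :: "'a \<Rightarrow> real"
  assumes F_add: "u \<in> L \<Longrightarrow> v \<in> L \<Longrightarrow> F (\<lambda>x. u x + v x) = F u + F v"
    and F_scale: "u \<in> L \<Longrightarrow> F (\<lambda>x. a * u x) = a * F u"
    and F_bound: "u \<in> L \<Longrightarrow> \<bar>F u\<bar> \<le> C * lux u"
    and C_pos: "0 < C"
    and w_L: "w \<in> L"
    and w_pos: "x \<in> space \<mu> \<Longrightarrow> 0 < w x"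
begin

text \<open>The limit inherits the majorant, so \<open>v n - v'\<close> is dominated by
  \<open>2 * u\<close> and tends to 0 in norm; boundedness of \<open>F\<close> does the
  rest.\<close>

lemma F_order_continuous:
  assumes u: "u \<in> L" and v: "\<And>n. v n \<in> borel_measurable \<mu>" "v' \<in> borel_measurable \<mu>"
    and le: "\<And>n. AE x in \<mu>. \<bar>v n x\<bar> \<le> \<bar>u x\<bar>" 
    and lim: "AE x in \<mu>. (\<lambda>n. v n x) \<longlonglongrightarrow> v' x"
  shows "v' \<in> L" and "(\<lambda>n. F (v n)) \<longlonglongrightarrow> F v'"
proof -
  have "AE x in \<mu>. \<forall>n. \<bar>v n x\<bar> \<le> \<bar>u x\<bar>" using le by (simp add: AE_all_countable)
  then have le': "AE x in \<mu>. \<bar>v' x\<bar> \<le> \<bar>u x\<bar>"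
    using lim
  proof eventually_elim
    case (elim x)
    show ?case
      by (rule LIMSEQ_le_const2[OF tendsto_rabs[OF elim(2)]]) (use elim(1) in auto)
  qed
  show v'L: "v' \<in> L"
    using L_dominated(1)[OF u v(2) le'] .
  have vL: "v n \<in> L" for n
    using L_dominated(1)[OF u v(1) le] .
  have "(\<lambda>n. lux (\<lambda>x. v n x + (- 1) * v' x)) \<longlonglongrightarrow> 0"
  proof (rule lux_order_continuous[OF L_scale[OF u, of 2]])
    show "AE x in \<mu>. \<bar>v n x + - 1 * v' x\<bar> \<le> \<bar>2 * u x\<bar>" for n
      using le[of n] le' by eventually_elim auto
    show "AE x in \<mu>. (\<lambda>n. v n x + - 1 * v' x) \<longlonglongrightarrow> 0"
      using lim by eventually_elim (auto intro: tendsto_eq_intros)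
  qed (use v in simp)
  then have lim0: "(\<lambda>n. C * lux (\<lambda>x. v n x + (- 1) * v' x)) \<longlonglongrightarrow> 0"
    by (rule tendsto_mult_right_zero)
  have le0: "norm (F (v n) - F v') \<le> C * lux (\<lambda>x. v n x + (- 1) * v' x)" for n
    using F_bound[OF L_add[OF vL[of n] L_scale[OF v'L, of "- 1"]]]
      F_add[OF vL[of n] L_scale[OF v'L, of "- 1"]] F_scale[OF v'L, of "- 1"] by simp
  have "(\<lambda>n. F (v n) - F v') \<longlonglongrightarrow> 0"
    by (rule Lim_null_comparison[OF always_eventually[OF allI, OF le0] lim0])
  then show "(\<lambda>n. F (v n)) \<longlonglongrightarrow> F v'"
    by (simp add: LIM_zero_iff)
qed

section \<open>The weighted set function and its density\<close>

abbreviation wt :: "'a set \<Rightarrow> 'a \<Rightarrow> real" where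
  "wt A \<equiv> \<lambda>x. w x * indicator A x"

lemma w_bounded_L:
  assumes f: "f \<in> borel_measurable \<mu>" and B: "\<And>x. x \<in> space \<mu> \<Longrightarrow> \<bar>f x\<bar> \<le> B"
  shows "(\<lambda>x. w x * f x) \<in> L"
proof (rule L_dominated(1)[OF L_scale[OF w_L, of B]])
  show "AE x in \<mu>. \<bar>w x * f x\<bar> \<le> \<bar>B * w x\<bar>"
  proof (rule AE_I2)
    fix x assume x: "x \<in> space \<mu>"
    have "\<bar>f x\<bar> \<le> \<bar>B\<bar>" using B[OF x] by simp
    then show "\<bar>w x * f x\<bar> \<le> \<bar>B * w x\<bar>"
      by (simp add: abs_mult mult.commute mult_right_mono)
  qed
qed (use f L_measurable[OF w_L] in simp)

lemma wt_L: "A \<in> sets \<mu> \<Longrightarrow> wt A \<in> L"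
  by (rule w_bounded_L[where B = 1]) (auto simp: indicator_def)

lemma lux_wt_mono: "A \<in> sets \<mu> \<Longrightarrow> B \<subseteq> A \<Longrightarrow> B \<in> sets \<mu> \<Longrightarrow> lux (wt B) \<le> lux (wt A)"
  using L_measurable[OF wt_L, of B] by (intro lux_mono[OF wt_L]) (auto simp: indicator_def)

lemma F_wt_bound:
  assumes "A \<in> sets \<mu>" "B \<subseteq> A" "B \<in> sets \<mu>"
  shows "F (wt B) \<le> C * lux (wt A)"
proof -
  have "F (wt B) \<le> C * lux (wt B)"
    using F_bound[OF wt_L[OF assms(3)]] by simp
  also have "\<dots> \<le> C * lux (wt A)"
    using lux_wt_mono[OF assms] C_pos by simp
  finally show ?thesis .
qed

lemma F_wt_union:
  assumes "A \<in> sets \<mu>" "B \<in> sets \<mu>" "A \<inter> B = {}"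
  shows "F (wt (A \<union> B)) = F (wt A) + F (wt B)"
proof -
  have "wt (A \<union> B) = (\<lambda>x. wt A x + wt B x)"
    using assms(3) by (auto simp: fun_eq_iff indicator_def)
  then show ?thesis using F_add[OF wt_L wt_L, OF assms(1,2)] by simp
qed

lemma lux_wt_tendsto_zero:
  assumes "range A \<subseteq> sets \<mu>" "decseq A" "(\<Inter>i. A i) = {}"
  shows "(\<lambda>i. lux (wt (A i))) \<longlonglongrightarrow> 0"
proof (rule lux_order_continuous[OF w_L])
  show "(\<lambda>x. w x * indicator (A n) x) \<in> borel_measurable \<mu>" for n
    using assms(1) L_measurable[OF w_L] by (intro borel_measurable_times) auto
  show "AE x in \<mu>. \<bar>w x * indicator (A n) x\<bar> \<le> \<bar>w x\<bar>" for n
    by (auto simp: indicator_def)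
  show "AE x in \<mu>. (\<lambda>n. w x * indicator (A n) x) \<longlonglongrightarrow> 0"
  proof (rule AE_I2)
    fix x
    have "(\<lambda>n. w x * indicator (A n) x) \<longlonglongrightarrow> w x * indicator (\<Inter>i. A i) x"
      by (intro tendsto_intros LIMSEQ_indicator_decseq assms)
    then show "(\<lambda>n. w x * indicator (A n) x) \<longlonglongrightarrow> 0" using assms(3) by simp
  qed
qed

lemma lux_wt_null:
  assumes "A \<in> null_sets \<mu>"
  shows "lux (wt A) = 0"
proof -
  have "AE x in \<mu>. wt A x = 0"
    using AE_not_in[OF assms] by eventually_elim simp
  then show ?thesis
    using lux_eq_zero_iff[OF wt_L] assms by auto
qed

text \<open>The positive part, in the sense of Jordan, of the signed measure \<open>A \<mapsto> F (wt A)\<close>.\<close>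

definition pos_part :: "'a set \<Rightarrow> real" where
  "pos_part A = (SUP B\<in>{B \<in> sets \<mu>. B \<subseteq> A}. F (wt B))"

lemma pos_part_upper:
  assumes "A \<in> sets \<mu>" "B \<in> sets \<mu>" "B \<subseteq> A"
  shows "F (wt B) \<le> pos_part A"
  unfolding pos_part_def
  by (rule cSUP_upper) (use assms F_wt_bound[OF assms(1)] in \<open>auto intro!: bdd_aboveI[of _ "C * lux (wt A)"]\<close>)

lemma pos_part_least:
  assumes "A \<in> sets \<mu>" "\<And>B. B \<in> sets \<mu> \<Longrightarrow> B \<subseteq> A \<Longrightarrow> F (wt B) \<le> r"
  shows "pos_part A \<le> r"
  unfolding pos_part_def by (rule cSUP_least) (use assms in auto)

lemma F_wt_empty: "F (wt {}) = 0"
  using F_wt_union[of "{}" "{}"] by simp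

lemma pos_part_nonneg: "A \<in> sets \<mu> \<Longrightarrow> 0 \<le> pos_part A"
  using pos_part_upper[of A "{}"] F_wt_empty by simp

lemma pos_part_bound: "A \<in> sets \<mu> \<Longrightarrow> pos_part A \<le> C * lux (wt A)"
  by (rule pos_part_least) (auto intro: F_wt_bound)

lemma pos_part_union:
  assumes A: "A \<in> sets \<mu>" "B \<in> sets \<mu>" "A \<inter> B = {}"
  shows "pos_part (A \<union> B) = pos_part A + pos_part B"
proof (rule antisym)
  show "pos_part (A \<union> B) \<le> pos_part A + pos_part B"
  proof (rule pos_part_least)
    fix D assume D: "D \<in> sets \<mu>" "D \<subseteq> A \<union> B"
    then have "D = (D \<inter> A) \<union> (D \<inter> B)" by auto
    then have "F (wt D) = F (wt (D \<inter> A)) + F (wt (D \<inter> B))"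
      using F_wt_union[of "D \<inter> A" "D \<inter> B"] A D by auto
    also have "\<dots> \<le> pos_part A + pos_part B"
      using A D by (intro add_mono pos_part_upper) auto
    finally show "F (wt D) \<le> pos_part A + pos_part B" .
  qed (use A in auto)
  \<comment> \<open>The two suprema are handled one at a time: with the other term moved to the
    right side, \<open>pos_part_least\<close> first reduces to a fixed \<open>D\<close>, then to a
    fixed \<open>E\<close>.\<close>
  have "pos_part A \<le> pos_part (A \<union> B) - pos_part B"
  proof (rule pos_part_least[OF A(1)])
    fix D assume D: "D \<in> sets \<mu>" "D \<subseteq> A"
    have "pos_part B \<le> pos_part (A \<union> B) - F (wt D)"
    proof (rule pos_part_least[OF A(2)])
      fix E assume E: "E \<in> sets \<mu>" "E \<subseteq> B"
      have "F (wt D) + F (wt E) = F (wt (D \<union> E))"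
        using F_wt_union[of D E] D E A by (metis disjoint_iff subset_iff)
      also have "\<dots> \<le> pos_part (A \<union> B)"
        using D E A by (intro pos_part_upper) auto
      finally show "F (wt E) \<le> pos_part (A \<union> B) - F (wt D)" by simp
    qed
    then show "F (wt D) \<le> pos_part (A \<union> B) - pos_part B" by simp
  qed
  then show "pos_part A + pos_part B \<le> pos_part (A \<union> B)" by simp
qed

text \<open>The set function is the difference of \<open>pos_part A\<close> and
  \<open>pos_part A - F (wt A)\<close>, the second nonnegative because \<open>A\<close> competes in
  its own supremum. Multiples of \<open>lux (wt A)\<close> control both terms, which gives
  continuity at the empty set and vanishing on null sets, so each has a density.\<close>

lemma exists_density:
  "\<exists>g. integrable \<mu> g \<and> (\<forall>A\<in>sets \<mu>. F (wt A) = (\<integral>x. g x * indicator A x \<partial>\<mu>))"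
proof -
  have lim: "(\<lambda>i. C * lux (wt (A i))) \<longlonglongrightarrow> 0"
    if "range A \<subseteq> sets \<mu>" "decseq A" "(\<Inter>i. A i) = {}" for A
    using tendsto_mult_right_zero[OF lux_wt_tendsto_zero[OF that]] .
  have p: "(\<lambda>i. pos_part (A i)) \<longlonglongrightarrow> 0"
    if "range A \<subseteq> sets \<mu>" "decseq A" "(\<Inter>i. A i) = {}" for A
  proof (rule Lim_null_comparison[OF _ lim[OF that]])
    show "\<forall>\<^sub>F n in sequentially. norm (pos_part (A n)) \<le> C * lux (wt (A n))"
      using that(1) pos_part_bound pos_part_nonneg by (intro always_eventually allI) (simp add: image_subset_iff)
  qed
  have m: "(\<lambda>i. pos_part (A i) - F (wt (A i))) \<longlonglongrightarrow> 0"
    if "range A \<subseteq> sets \<mu>" "decseq A" "(\<Inter>i. A i) = {}" for A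
  proof -
    have "(\<lambda>i. F (wt (A i))) \<longlonglongrightarrow> 0"
    proof (rule Lim_null_comparison[OF _ lim[OF that]])
      show "\<forall>\<^sub>F n in sequentially. norm (F (wt (A n))) \<le> C * lux (wt (A n))"
        using that(1) F_bound[OF wt_L] by (intro always_eventually allI) (simp add: image_subset_iff)
    qed
    from tendsto_diff[OF p[OF that] this] show ?thesis by simp
  qed
  have null: "pos_part A = 0" "F (wt A) = 0" if "A \<in> null_sets \<mu>" for A
    using pos_part_bound[of A] pos_part_nonneg[of A] F_bound[OF wt_L, of A] lux_wt_null[OF that] that
    by auto
  have "\<exists>g. integrable \<mu> g \<and>
      (\<forall>A\<in>sets \<mu>. (\<integral>x. g x * indicator A x \<partial>\<mu>) = pos_part A)"
    by (rule Radon_Nikodym_real) (simp_all add: pos_part_nonneg pos_part_union null p)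
  then obtain gp where gp: "integrable \<mu> gp"
    "\<And>A. A \<in> sets \<mu> \<Longrightarrow> (\<integral>x. gp x * indicator A x \<partial>\<mu>) = pos_part A"
    by blast
  have "\<exists>g. integrable \<mu> g \<and>
      (\<forall>A\<in>sets \<mu>. (\<integral>x. g x * indicator A x \<partial>\<mu>) = pos_part A - F (wt A))"
    by (rule Radon_Nikodym_real)
      (simp_all add: pos_part_upper pos_part_union F_wt_union null m)
  then obtain gm where gm: "integrable \<mu> gm"
    "\<And>A. A \<in> sets \<mu> \<Longrightarrow> (\<integral>x. gm x * indicator A x \<partial>\<mu>) = pos_part A - F (wt A)"
    by blast
  have "F (wt A) = (\<integral>x. (gp x - gm x) * indicator A x \<partial>\<mu>)" if A: "A \<in> sets \<mu>" for A
  proof -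
    have "integrable \<mu> (\<lambda>x. gp x * indicator A x)" "integrable \<mu> (\<lambda>x. gm x * indicator A x)"
      using A gp(1) gm(1) by (auto intro: integrable_real_mult_indicator)
    then show ?thesis using gp(2)[OF A] gm(2)[OF A] by (simp add: left_diff_distrib)
  qed
  then show ?thesis
    using gp(1) gm(1) by (intro exI[of _ "\<lambda>x. gp x - gm x"]) auto
qed

section \<open>From indicators to bounded functions\<close>

lemma integrable_bounded_mult:
  fixes g f :: "'a \<Rightarrow> real"
  assumes g: "integrable \<mu> g" and f: "f \<in> borel_measurable \<mu>"
    and B: "\<And>x. x \<in> space \<mu> \<Longrightarrow> \<bar>f x\<bar> \<le> B"
  shows "integrable \<mu> (\<lambda>x. g x * f x)"
proof (rule Bochner_Integration.integrable_bound)
  show "integrable \<mu> (\<lambda>x. B * g x)" using g by simp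
  show "AE x in \<mu>. norm (g x * f x) \<le> norm (B * g x)"
  proof (rule AE_I2)
    fix x assume x: "x \<in> space \<mu>"
    have "\<bar>f x\<bar> \<le> \<bar>B\<bar>" using B[OF x] by simp
    then show "norm (g x * f x) \<le> norm (B * g x)"
      by (simp add: abs_mult mult.commute mult_right_mono)
  qed
qed (use g f in auto)

text \<open>Both sides are linear in \<open>f\<close> and respect bounded increasing limits: the
  left by order continuity with majorant \<open>B * w\<close>, the right by dominated convergence
  with majorant \<open>B * \<bar>g\<bar>\<close>. The bound \<open>B\<close> is generalised in the
  induction because the pieces of \<open>f\<close> have bounds of their own.\<close>

lemma F_bounded_nonneg:
  assumes g: "integrable \<mu> g" "\<And>A. A \<in> sets \<mu> \<Longrightarrow> F (wt A) = (\<integral>x. g x * indicator A x \<partial>\<mu>)"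
    and f: "f \<in> borel_measurable \<mu>" "\<And>x. 0 \<le> f x" "\<And>x. x \<in> space \<mu> \<Longrightarrow> f x \<le> B"
  shows "F (\<lambda>x. w x * f x) = (\<integral>x. g x * f x \<partial>\<mu>)"
  using f
proof (induction arbitrary: B rule: borel_measurable_induct_real)
  case (set A)
  then show ?case using g(2) by simp
next
  case (mult u c)
  show ?case
  \<comment> \<open>For \<open>c = 0\<close> the bound on the product says nothing about
    \<open>u\<close>, so the induction hypothesis is out of reach.\<close>
  proof (cases "c = 0")
    case True
    then show ?thesis using F_scale[OF L_zero, of 0] by simp
  next
    case False
    then have c: "0 < c" using mult by simp
    have uB: "u x \<le> B / c" if "x \<in> space \<mu>" for x
      using mult.prems[OF that] c by (simp add: pos_le_divide_eq mult.commute)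
    have "(\<lambda>x. w x * u x) \<in> L"
      using mult uB by (intro w_bounded_L[where B = "B / c"]) auto
    then have "F (\<lambda>x. c * (w x * u x)) = c * (\<integral>x. g x * u x \<partial>\<mu>)"
      using F_scale mult.IH[OF uB] by simp
    then show ?thesis
      by (simp add: mult.left_commute)
  qed
next
  case (add u v)
  have uB: "u x \<le> B" if "x \<in> space \<mu>" for x
    using add.prems[OF that] add.hyps(2,4)[of x] by linarith
  have vB: "v x \<le> B" if "x \<in> space \<mu>" for x
    using add.prems[OF that] add.hyps(2,4)[of x] by linarith
  have "(\<lambda>x. w x * u x) \<in> L" "(\<lambda>x. w x * v x) \<in> L"
    using add uB vB by (auto intro!: w_bounded_L[where B = B])
  moreover have "integrable \<mu> (\<lambda>x. g x * u x)" "integrable \<mu> (\<lambda>x. g x * v x)"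
    using add uB vB by (auto intro!: integrable_bounded_mult[where B = B] g)
  ultimately show ?case
    using F_add[of "\<lambda>x. w x * v x" "\<lambda>x. w x * u x"] add.IH(1)[OF uB] add.IH(2)[OF vB]
    by (simp add: distrib_left)
next
  case (seq U)
  have Uf: "U i x \<le> f x" if "x \<in> space \<mu>" for i x
    using seq.hyps(3) seq.hyps(4)[OF that] by (intro incseq_le) (auto simp: incseq_def le_fun_def)
  have UB: "U i x \<le> B" if "x \<in> space \<mu>" for i x
    using Uf[OF that, of i] seq.prems[OF that] by simp
  have f_meas: "f \<in> borel_measurable \<mu>"
    by (rule borel_measurable_LIMSEQ_real[OF seq.hyps(4) seq.hyps(1)])
  have IH: "F (\<lambda>x. w x * U i x) = (\<integral>x. g x * U i x \<partial>\<mu>)" for i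
    using seq.IH[OF UB] .
  have "(\<lambda>i. F (\<lambda>x. w x * U i x)) \<longlonglongrightarrow> F (\<lambda>x. w x * f x)"
  proof (rule F_order_continuous(2)[OF L_scale[OF w_L, of B]])
    show "(\<lambda>x. w x * U n x) \<in> borel_measurable \<mu>" for n
      using seq.hyps(1) L_measurable[OF w_L] by simp
    show "(\<lambda>x. w x * f x) \<in> borel_measurable \<mu>"
      using f_meas L_measurable[OF w_L] by simp
    show "AE x in \<mu>. \<bar>w x * U n x\<bar> \<le> \<bar>B * w x\<bar>" for n
    proof (rule AE_I2)
      fix x assume x: "x \<in> space \<mu>"
      have "\<bar>U n x\<bar> \<le> \<bar>B\<bar>" using UB[OF x, of n] seq.hyps(2)[of n x] by simp
      then show "\<bar>w x * U n x\<bar> \<le> \<bar>B * w x\<bar>"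
        by (subst mult.commute) (auto simp: abs_mult intro!: mult_right_mono)
    qed
    show "AE x in \<mu>. (\<lambda>n. w x * U n x) \<longlonglongrightarrow> w x * f x"
      using seq.hyps(4) by (auto intro!: tendsto_intros)
  qed
  moreover have "(\<lambda>i. \<integral>x. g x * U i x \<partial>\<mu>) \<longlonglongrightarrow> (\<integral>x. g x * f x \<partial>\<mu>)"
  proof (rule integral_dominated_convergence)
    show "integrable \<mu> (\<lambda>x. B * \<bar>g x\<bar>)" using g by simp
    show "(\<lambda>x. g x * f x) \<in> borel_measurable \<mu>" using f_meas g by simp
    show "(\<lambda>x. g x * U i x) \<in> borel_measurable \<mu>" for i using seq.hyps(1) g by simp
    show "AE x in \<mu>. (\<lambda>i. g x * U i x) \<longlonglongrightarrow> g x * f x"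
      using seq.hyps(4) by (auto intro!: tendsto_intros)
    show "AE x in \<mu>. norm (g x * U i x) \<le> B * \<bar>g x\<bar>" for i
    proof (rule AE_I2)
      fix x assume x: "x \<in> space \<mu>"
      show "norm (g x * U i x) \<le> B * \<bar>g x\<bar>"
        using UB[OF x, of i] seq.hyps(2)[of i x]
        by (subst mult.commute) (auto simp: abs_mult intro!: mult_right_mono)
    qed
  qed
  ultimately show ?case
    using IH LIMSEQ_unique by simp
qed

lemma F_bounded:
  assumes g: "integrable \<mu> g" "\<And>A. A \<in> sets \<mu> \<Longrightarrow> F (wt A) = (\<integral>x. g x * indicator A x \<partial>\<mu>)"
    and f: "f \<in> borel_measurable \<mu>" "\<And>x. x \<in> space \<mu> \<Longrightarrow> \<bar>f x\<bar> \<le> B"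
  shows "F (\<lambda>x. w x * f x) = (\<integral>x. g x * f x \<partial>\<mu>)"
proof -
  define p n where "p x = max 0 (f x)" and "n x = max 0 (- f x)" for x
  have meas: "p \<in> borel_measurable \<mu>" "n \<in> borel_measurable \<mu>"
    unfolding p_def n_def using f(1) by auto
  have nonneg: "0 \<le> p x" "0 \<le> n x" for x
    by (auto simp: p_def n_def)
  have bounded: "p x \<le> B" "n x \<le> B" if "x \<in> space \<mu>" for x
    using f(2)[OF that] by (auto simp: p_def n_def)
  have L: "(\<lambda>x. w x * p x) \<in> L" "(\<lambda>x. w x * n x) \<in> L"
    using bounded nonneg meas by (auto intro!: w_bounded_L[where B = B])
  have int: "integrable \<mu> (\<lambda>x. g x * p x)" "integrable \<mu> (\<lambda>x. g x * n x)"
    using bounded nonneg meas by (auto intro!: integrable_bounded_mult[where B = B] g)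
  have eq: "f x = p x - n x" for x by (auto simp: p_def n_def)
  have "F (\<lambda>x. w x * f x) = F (\<lambda>x. w x * p x + (- 1) * (w x * n x))"
    by (simp add: eq right_diff_distrib)
  also have "\<dots> = F (\<lambda>x. w x * p x) - F (\<lambda>x. w x * n x)"
    using F_add[OF L(1) L_scale[OF L(2), of "- 1"]] F_scale[OF L(2), of "- 1"] by simp
  also have "\<dots> = (\<integral>x. g x * p x \<partial>\<mu>) - (\<integral>x. g x * n x \<partial>\<mu>)"
    using F_bounded_nonneg[OF g, of p B] F_bounded_nonneg[OF g, of n B] meas nonneg bounded by simp
  also have "\<dots> = (\<integral>x. g x * f x \<partial>\<mu>)"
    using int by (simp add: eq right_diff_distrib)
  finally show ?thesis .
qed

end

section \<open>Complementary pairs\<close>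

text \<open>The three conditions say that each function is the Legendre transform of the other:
  \<open>young\<close> is the upper bound for both suprema at once, and the two others say that no
  smaller number is a bound.\<close>

locale complementary_integrands =
  P: Delta2_integrand \<mu> \<Phi> + Q: Delta2_integrand \<mu> \<Psi>
  for \<mu> :: "'a measure" and \<Phi> \<Psi> +
  assumes young: "x \<in> space \<mu> \<Longrightarrow> 0 \<le> s \<Longrightarrow> 0 \<le> t \<Longrightarrow> s * t \<le> \<Phi> x s + \<Psi> x t"
    and \<Psi>_least: "x \<in> space \<mu> \<Longrightarrow> 0 \<le> t \<Longrightarrow> r < \<Psi> x t \<Longrightarrow> \<exists>s\<ge>0. r < s * t - \<Phi> x s"
    and \<Phi>_least: "x \<in> space \<mu> \<Longrightarrow> 0 \<le> s \<Longrightarrow> r < \<Phi> x s \<Longrightarrow> \<exists>t\<ge>0. r < s * t - \<Psi> x t"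
begin

lemma swap: "complementary_integrands \<mu> \<Psi> \<Phi>"
proof (unfold_locales, goal_cases)
  case (1 x s t)
  then show ?case using young[of x t s] by (simp add: mult.commute add.commute)
next
  case (2 x t r)
  then show ?case using \<Phi>_least[of x t r] by (auto simp: mult.commute)
next
  case (3 x s r)
  then show ?case using \<Psi>_least[of x s r] by (auto simp: mult.commute)
qed

lemma young_abs: "x \<in> space \<mu> \<Longrightarrow> \<bar>a * b\<bar> \<le> \<Phi> x \<bar>a\<bar> + \<Psi> x \<bar>b\<bar>"
  using young[of x "\<bar>a\<bar>" "\<bar>b\<bar>"] by (simp add: abs_mult)

lemma integrable_mult:
  assumes u: "u \<in> P.L" and v: "v \<in> Q.L"
  shows "integrable \<mu> (\<lambda>x. u x * v x)"
proof (rule Bochner_Integration.integrable_bound)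
  show "integrable \<mu> (\<lambda>x. \<Phi> x \<bar>u x\<bar> + \<Psi> x \<bar>v x\<bar>)"
    using P.L_integrable[OF u] Q.L_integrable[OF v] by simp
  show "AE x in \<mu>. norm (u x * v x) \<le> norm (\<Phi> x \<bar>u x\<bar> + \<Psi> x \<bar>v x\<bar>)"
  proof (rule AE_I2)
    fix x assume x: "x \<in> space \<mu>"
    show "norm (u x * v x) \<le> norm (\<Phi> x \<bar>u x\<bar> + \<Psi> x \<bar>v x\<bar>)"
      using young_abs[OF x, of "u x" "v x"] by simp
  qed
qed (use P.L_measurable[OF u] Q.L_measurable[OF v] in simp)

text \<open>Integrating Young's inequality for \<open>u / a\<close> and \<open>v / b\<close> costs
  at most 1 for each modular, whence the factor 2. The numbers \<open>a\<close> and \<open>b\<close>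
  stay strictly above the norms and descend to them at the end, which covers vanishing norms as
  well.\<close>

lemma hoelder:
  assumes u: "u \<in> P.L" and v: "v \<in> Q.L"
  shows "\<bar>\<integral>x. u x * v x \<partial>\<mu>\<bar> \<le> 2 * P.lux u * Q.lux v"
proof -
  have *: "\<bar>\<integral>x. u x * v x \<partial>\<mu>\<bar> \<le> 2 * a * b" if a: "P.lux u < a" and b: "Q.lux v < b" for a b
  proof -
    have pos: "0 < a" "0 < b"
      using a b P.lux_nonneg[OF u] Q.lux_nonneg[OF v] by auto
    have ua: "(\<lambda>x. u x / a) \<in> P.L" and vb: "(\<lambda>x. v x / b) \<in> Q.L"
      by (auto intro: P.L_divide Q.L_divide u v)
    have "\<bar>\<integral>x. u x / a * (v x / b) \<partial>\<mu>\<bar> \<le> (\<integral>x. \<bar>u x / a * (v x / b)\<bar> \<partial>\<mu>)"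
      by (rule integral_abs_bound)
    also have "\<dots> \<le> (\<integral>x. \<Phi> x \<bar>u x / a\<bar> + \<Psi> x \<bar>v x / b\<bar> \<partial>\<mu>)"
    proof (rule integral_mono)
      show "integrable \<mu> (\<lambda>x. \<bar>u x / a * (v x / b)\<bar>)"
        using integrable_mult[OF ua vb] by (rule integrable_abs)
      show "integrable \<mu> (\<lambda>x. \<Phi> x \<bar>u x / a\<bar> + \<Psi> x \<bar>v x / b\<bar>)"
        using P.L_integrable[OF ua] Q.L_integrable[OF vb] by simp
    qed (rule young_abs)
    also have "\<dots> = P.modu (\<lambda>x. u x / a) + Q.modu (\<lambda>x. v x / b)"
      unfolding P.modu_def Q.modu_def
      using P.L_integrable[OF ua] Q.L_integrable[OF vb] by simp
    also have "\<dots> \<le> 2"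
      using P.modu_le_one[OF u a] Q.modu_le_one[OF v b] by simp
    finally have "\<bar>(\<integral>x. u x * v x \<partial>\<mu>) / (a * b)\<bar> \<le> 2" by simp
    then show ?thesis
      using pos by (simp add: abs_divide divide_le_eq mult.assoc)
  qed
  have "((\<lambda>e. 2 * (P.lux u + e) * (Q.lux v + e)) \<longlongrightarrow> 2 * (P.lux u + 0) * (Q.lux v + 0)) (at_right 0)"
    by (intro tendsto_intros)
  moreover have "\<forall>\<^sub>F e in at_right 0. \<bar>\<integral>x. u x * v x \<partial>\<mu>\<bar> \<le> 2 * (P.lux u + e) * (Q.lux v + e)"
    using eventually_at_right_less[of 0]
  proof eventually_elim
    case (elim e)
    then show ?case using *[of "P.lux u + e" "Q.lux v + e"] by simp
  qed
  ultimately have "\<bar>\<integral>x. u x * v x \<partial>\<mu>\<bar> \<le> 2 * (P.lux u + 0) * (Q.lux v + 0)"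
    by (rule tendsto_lowerbound) simp
  then show ?thesis by simp
qed

text \<open>Continuity of \<open>s * t - \<Phi> x s\<close> allows a nearly optimal \<open>s\<close>
  to be moved to a point \<open>q * c\<close> with \<open>q\<close> rational. The scale
  \<open>c\<close> will be \<open>w x\<close>, so one sequence of rationals serves every
  \<open>x\<close>.\<close>

lemma \<Psi>_least_dense:
  assumes x: "x \<in> space \<mu>" and t: "0 \<le> t" and r: "r < \<Psi> x t" and c: "0 < c"
  obtains q where "q \<in> \<rat>" "0 \<le> q" "r < q * c * t - \<Phi> x (q * c)"
proof -
  obtain s where s: "0 \<le> s" "r < s * t - \<Phi> x s"
    using \<Psi>_least[OF x t r] by auto
  have "continuous_on {0..} (\<lambda>s. s * t - \<Phi> x s)"
    using P.continuous_\<Phi>[OF x] by (intro continuous_intros)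
  then have "((\<lambda>s. s * t - \<Phi> x s) \<longlongrightarrow> s * t - \<Phi> x s) (at s within {0..})"
    using s(1) by (simp add: continuous_on_def)
  then have "\<forall>\<^sub>F s' in at s within {0..}. r < s' * t - \<Phi> x s'"
    using s(2) by (rule order_tendstoD)
  then obtain d where d: "0 < d"
    "\<And>s'. 0 \<le> s' \<Longrightarrow> s' \<noteq> s \<Longrightarrow> dist s' s < d \<Longrightarrow> r < s' * t - \<Phi> x s'"
    by (auto simp: eventually_at)
  \<comment> \<open>Approaching \<open>s\<close> from the right keeps \<open>q\<close> nonnegative
    even for \<open>s = 0\<close>.\<close>
  obtain q where q: "q \<in> \<rat>" "s / c < q" "q < (s + d) / c"
    using Rats_dense_in_real[of "s / c" "(s + d) / c"] d(1) c by (auto simp: divide_strict_right_mono)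
  have "s < q * c" "q * c < s + d"
    using q c by (auto simp: pos_divide_less_eq pos_less_divide_eq)
  moreover have "0 \<le> q"
    using q(2) s(1) c by (meson divide_nonneg_pos less_eq_real_def order_trans)
  ultimately show thesis
    using that[OF q(1)] d(2)[of "q * c"] s(1) c by (simp add: dist_real_def)
qed

text \<open>
  In the proof \<open>r n x\<close> maximises \<open>s \<mapsto> s w \<bar>v\<bar> - \<Phi> x (s w)\<close> over the first \<open>n\<close> nonnegative
  rationals. Testing the functional against \<open>w * r n\<close> bounds the modular of \<open>v\<close>.
\<close>

lemma dual_modular_bound:
  assumes w: "w \<in> P.L" "\<And>x. x \<in> space \<mu> \<Longrightarrow> 0 < w x"
    and v: "v \<in> borel_measurable \<mu>"
    and int: "integrable \<mu> (\<lambda>x. w x * v x)"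
    and bound: "\<And>f B. f \<in> borel_measurable \<mu> \<Longrightarrow> (\<And>x. x \<in> space \<mu> \<Longrightarrow> 0 \<le> f x) \<Longrightarrow>
      (\<And>x. x \<in> space \<mu> \<Longrightarrow> f x \<le> B) \<Longrightarrow>
      (\<integral>x. w x * \<bar>v x\<bar> * f x \<partial>\<mu>) \<le> 1 + P.modu (\<lambda>x. w x * f x)"
  shows "v \<in> Q.L"
proof -
  define q where "q = from_nat_into {q::real. q \<in> \<rat> \<and> 0 \<le> q}"
  have ne: "{q::real. q \<in> \<rat> \<and> 0 \<le> q} \<noteq> {}"
    by (auto intro!: exI[of _ 0])
  have q_nonneg: "0 \<le> q n" for n
    using from_nat_into[OF ne, of n] by (simp add: q_def)
  have q_surj: "\<exists>n. q n = s" if "s \<in> \<rat>" "0 \<le> s" for s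
  proof -
    have "countable {q::real. q \<in> \<rat> \<and> 0 \<le> q}"
      by (rule countable_subset[OF _ countable_rat]) auto
    then show ?thesis
      using from_nat_into_surj[of "{q::real. q \<in> \<rat> \<and> 0 \<le> q}" s] that by (auto simp: q_def)
  qed
  define G where "G x s = s * w x * \<bar>v x\<bar> - \<Phi> x (s * w x)" for x s
  \<comment> \<open>The maximiser is built by recursion so that measurability and boundedness follow
    by induction. The start 0 is harmless, since \<open>G x 0 = 0\<close> on the space, and
    \<open>r (Suc n)\<close> has already been compared with \<open>q n\<close>.\<close>
  define r where "r = rec_nat (\<lambda>x. 0) (\<lambda>n rn x. if G x (rn x) < G x (q n) then q n else rn x)"
  have r0: "r 0 x = 0" for x by (simp add: r_def)
  have rS: "r (Suc n) x = (if G x (r n x) < G x (q n) then q n else r n x)" for n x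
    by (simp add: r_def)
  have r_nonneg: "0 \<le> r n x" for n x
    by (induction n) (auto simp: r0 rS q_nonneg)
  have G_meas: "(\<lambda>x. G x (f x)) \<in> borel_measurable \<mu>"
    if f: "f \<in> borel_measurable \<mu>" "\<And>x. 0 \<le> f x" for f
  proof -
    \<comment> \<open>The absolute value, redundant on the space since \<open>w\<close> is positive,
      brings the term into the form whose measurability is known.\<close>
    have "(\<lambda>x. f x * w x * \<bar>v x\<bar> - \<Phi> x \<bar>f x * w x\<bar>) \<in> borel_measurable \<mu>"
      using f v P.L_measurable[OF w(1)] by (intro borel_measurable_diff P.borel_measurable_\<Phi>_abs) auto
    moreover have "f x * w x * \<bar>v x\<bar> - \<Phi> x \<bar>f x * w x\<bar> = G x (f x)" if "x \<in> space \<mu>" for x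
      using f(2)[of x] w(2)[OF that] by (simp add: G_def)
    ultimately show ?thesis
      by (simp cong: measurable_cong)
  qed
  have r_meas: "r n \<in> borel_measurable \<mu>" for n
  proof (induction n)
    case 0
    then show ?case by (simp add: r_def)
  next
    case (Suc n)
    have "(\<lambda>x. if G x (r n x) < G x (q n) then q n else r n x) \<in> borel_measurable \<mu>"
      using Suc G_meas[OF Suc r_nonneg] G_meas[of "\<lambda>x. q n"] q_nonneg by measurable
    then show ?case by (simp add: rS[abs_def])
  qed
  have r_bound: "\<exists>B. \<forall>x. r n x \<le> B" for n
  proof (induction n)
    case (Suc n)
    then obtain B where "\<forall>x. r n x \<le> B" by blast
    then have "\<forall>x. r (Suc n) x \<le> max B (q n)" by (auto simp: rS le_max_iff_disj)
    then show ?case by blast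
  qed (auto simp: r0)
  define f where "f n x = G x (r n x)" for n x
  have f_Suc: "f n x \<le> f (Suc n) x" "G x (q n) \<le> f (Suc n) x" for n x
    by (auto simp: f_def rS)
  have f_inc: "incseq (\<lambda>n. f n x)" for x
    using f_Suc by (intro incseq_SucI)
  have f_le: "f n x \<le> \<Psi> x \<bar>v x\<bar>" if x: "x \<in> space \<mu>" for n x
    using young[OF x, of "r n x * w x" "\<bar>v x\<bar>"] w(2)[OF x] r_nonneg[of n x]
    by (simp add: f_def G_def)
  have f_lim: "(\<lambda>n. f n x) \<longlonglongrightarrow> \<Psi> x \<bar>v x\<bar>" if x: "x \<in> space \<mu>" for x
  proof (rule increasing_tendsto)
    show "\<forall>\<^sub>F n in sequentially. f n x \<le> \<Psi> x \<bar>v x\<bar>"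
      using f_le[OF x] by simp
    fix a assume "a < \<Psi> x \<bar>v x\<bar>"
    then obtain s where s: "s \<in> \<rat>" "0 \<le> s" "a < s * w x * \<bar>v x\<bar> - \<Phi> x (s * w x)"
      using \<Psi>_least_dense[OF x, of "\<bar>v x\<bar>" a "w x"] w(2)[OF x] by auto
    then obtain n where "q n = s" using q_surj by blast
    then have n: "a < f (Suc n) x"
      using s(3) f_Suc(2)[of x n] by (simp add: G_def)
    have "a < f m x" if "m \<ge> Suc n" for m
      using n incseqD[OF f_inc that, of x] by linarith
    then show "\<forall>\<^sub>F n in sequentially. a < f n x"
      by (auto simp: eventually_sequentially)
  qed
  \<comment> \<open>The modular subtracted in \<open>f n\<close> is the one that
    \<open>bound\<close> adds on its right side. They cancel, so all these integrals are at most 1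
    and monotone convergence yields a finite modular of \<open>v\<close>.\<close>
  have f_int: "integrable \<mu> (f n)" "integral\<^sup>L \<mu> (f n) \<le> 1" for n
  proof -
    obtain B where B: "\<And>x. r n x \<le> B" using r_bound[of n] by blast
    have wr: "(\<lambda>x. w x * r n x) \<in> P.L"
    proof (rule P.L_dominated(1)[OF P.L_scale[OF w(1), of B]])
      show "AE x in \<mu>. \<bar>w x * r n x\<bar> \<le> \<bar>B * w x\<bar>"
        using B r_nonneg[of n] order_trans[OF r_nonneg B]
        by (subst mult.commute) (auto simp: abs_mult intro!: mult_right_mono)
    qed (use r_meas P.L_measurable[OF w(1)] in simp)
    have i1: "integrable \<mu> (\<lambda>x. w x * \<bar>v x\<bar> * r n x)"
    proof (rule Bochner_Integration.integrable_bound)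
      show "integrable \<mu> (\<lambda>x. B * (w x * v x))" using int by simp
      show "AE x in \<mu>. norm (w x * \<bar>v x\<bar> * r n x) \<le> norm (B * (w x * v x))"
        using B r_nonneg[of n] order_trans[OF r_nonneg B]
        by (subst mult.commute) (auto simp: abs_mult intro!: mult_right_mono)
    qed (use r_meas v P.L_measurable[OF w(1)] in simp)
    have i2: "integrable \<mu> (\<lambda>x. \<Phi> x \<bar>w x * r n x\<bar>)"
      by (rule P.L_integrable[OF wr])
    have eq: "f n x = w x * \<bar>v x\<bar> * r n x - \<Phi> x \<bar>w x * r n x\<bar>" if "x \<in> space \<mu>" for x
      using w(2)[OF that] r_nonneg[of n x] by (simp add: f_def G_def mult_ac)
    have "integrable \<mu> (\<lambda>x. w x * \<bar>v x\<bar> * r n x - \<Phi> x \<bar>w x * r n x\<bar>)"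
      using i1 i2 by simp
    then show "integrable \<mu> (f n)"
      using eq by (simp cong: Bochner_Integration.integrable_cong)
    have "integral\<^sup>L \<mu> (f n) = (\<integral>x. w x * \<bar>v x\<bar> * r n x - \<Phi> x \<bar>w x * r n x\<bar> \<partial>\<mu>)"
      using eq by (intro Bochner_Integration.integral_cong) auto
    also have "\<dots> = (\<integral>x. w x * \<bar>v x\<bar> * r n x \<partial>\<mu>) - P.modu (\<lambda>x. w x * r n x)"
      using i1 i2 by (simp add: P.modu_def)
    also have "\<dots> \<le> 1"
      using bound[OF r_meas r_nonneg B] by simp
    finally show "integral\<^sup>L \<mu> (f n) \<le> 1" .
  qed
  have inc: "incseq (\<lambda>n. integral\<^sup>L \<mu> (f n))"
    using f_int f_Suc by (intro incseq_SucI integral_mono) auto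
  then obtain l where l: "(\<lambda>n. integral\<^sup>L \<mu> (f n)) \<longlonglongrightarrow> l"
    by (rule incseq_convergent[where B = 1]) (use f_int(2) in auto)
  have "integrable \<mu> (\<lambda>x. \<Psi> x \<bar>v x\<bar>)"
  proof (rule integrable_monotone_convergence[OF f_int(1) _ _ l])
    show "AE x in \<mu>. mono (\<lambda>n. f n x)" using f_inc by auto
    show "AE x in \<mu>. (\<lambda>i. f i x) \<longlonglongrightarrow> \<Psi> x \<bar>v x\<bar>" using f_lim by auto
  qed (rule Q.borel_measurable_\<Phi>_abs[OF v])
  then show ?thesis using v by (simp add: Q.L_def)
qed

text \<open>On products of \<open>w\<close> with bounded functions \<open>F\<close> is integration
  against \<open>g\<close>. Dividing \<open>F\<close> by \<open>c\<close> makes its norm at most 1,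
  and then \<open>lux_le_modu\<close> supplies the hypothesis of \<open>dual_modular_bound\<close>
  for \<open>v / c\<close>. Truncating \<open>u / w\<close> extends the formula from these products
  to all of \<open>L\<close>.\<close>

theorem dual_representation:
  assumes add: "\<And>u v. u \<in> P.L \<Longrightarrow> v \<in> P.L \<Longrightarrow> F (\<lambda>x. u x + v x) = F u + F v"
    and scale: "\<And>a u. u \<in> P.L \<Longrightarrow> F (\<lambda>x. a * u x) = a * F u"
    and bound: "\<And>u. u \<in> P.L \<Longrightarrow> \<bar>F u\<bar> \<le> C * P.lux u"
  shows "\<exists>v\<in>Q.L. \<forall>u\<in>P.L. F u = (\<integral>x. u x * v x \<partial>\<mu>)"
proof -
  obtain w where w: "w \<in> P.L" "\<And>x. x \<in> space \<mu> \<Longrightarrow> 0 < w x"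
    using P.obtain_positive_in_L by blast
  \<comment> \<open>Positive whatever the sign of \<open>C\<close>, so that division by it is
    possible.\<close>
  define c where "c = \<bar>C\<bar> + 1"
  have c: "0 < c" by (simp add: c_def)
  have bound_c: "\<bar>F u\<bar> \<le> c * P.lux u" if "u \<in> P.L" for u
  proof -
    have "C * P.lux u \<le> c * P.lux u"
      using P.lux_nonneg[OF that] by (intro mult_right_mono) (auto simp: c_def)
    then show ?thesis using bound[OF that] by simp
  qed
  interpret B: bounded_functional \<mu> \<Phi> F c w
    by unfold_locales (use add scale bound_c c w in auto)
  obtain g where g: "integrable \<mu> g"
    "\<And>A. A \<in> sets \<mu> \<Longrightarrow> F (B.wt A) = (\<integral>x. g x * indicator A x \<partial>\<mu>)"
    using B.exists_density by blast
  have F_eq: "F (\<lambda>x. w x * f x) = (\<integral>x. g x * f x \<partial>\<mu>)"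
    if "f \<in> borel_measurable \<mu>" "\<And>x. x \<in> space \<mu> \<Longrightarrow> \<bar>f x\<bar> \<le> B" for f B
    using B.F_bounded[of g f B] g that by blast
  define v where "v x = g x / w x" for x
  have v_meas: "v \<in> borel_measurable \<mu>"
    unfolding v_def using g(1) P.L_measurable[OF w(1)] by auto
  have wv: "w x * v x = g x" if "x \<in> space \<mu>" for x
    using w(2)[OF that] by (simp add: v_def)
  have "(\<lambda>x. v x / c) \<in> Q.L"
  proof (rule dual_modular_bound[OF w])
    show "(\<lambda>x. v x / c) \<in> borel_measurable \<mu>" using v_meas by simp
    have "integrable \<mu> (\<lambda>x. g x / c)" using g(1) by simp
    moreover have "integrable \<mu> (\<lambda>x. g x / c) \<longleftrightarrow> integrable \<mu> (\<lambda>x. w x * (v x / c))"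
      by (rule Bochner_Integration.integrable_cong) (simp_all add: wv[symmetric])
    ultimately show "integrable \<mu> (\<lambda>x. w x * (v x / c))" by simp
    fix f :: "'a \<Rightarrow> real" and B
    assume f: "f \<in> borel_measurable \<mu>" "\<And>x. x \<in> space \<mu> \<Longrightarrow> 0 \<le> f x"
      "\<And>x. x \<in> space \<mu> \<Longrightarrow> f x \<le> B"
    \<comment> \<open>The factor \<open>sgn (g x)\<close> turns \<open>g\<close> into
      \<open>\<bar>g\<bar>\<close> without raising the norm of the test function.\<close>
    have sf: "(\<lambda>x. sgn (g x) * f x) \<in> borel_measurable \<mu>"
      using g(1) f(1) by simp
    have sf_le: "\<bar>sgn (g x) * f x\<bar> \<le> B" if "x \<in> space \<mu>" for x
      using f(2,3)[OF that] by (auto simp: abs_mult sgn_if)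
    have wf: "(\<lambda>x. w x * f x) \<in> P.L"
      using f by (intro B.w_bounded_L[where B = B]) auto
    have wsf: "(\<lambda>x. w x * (sgn (g x) * f x)) \<in> P.L"
      by (rule B.w_bounded_L[OF sf sf_le])
    have "(\<integral>x. w x * \<bar>v x / c\<bar> * f x \<partial>\<mu>) = (\<integral>x. g x * (sgn (g x) * f x) / c \<partial>\<mu>)"
    proof (rule Bochner_Integration.integral_cong)
      fix x assume x: "x \<in> space \<mu>"
      have "w x * \<bar>v x\<bar> = \<bar>g x\<bar>" using wv[OF x] w(2)[OF x] by (metis abs_mult abs_of_pos)
      then show "w x * \<bar>v x / c\<bar> * f x = g x * (sgn (g x) * f x) / c"
        using c by (simp add: abs_divide abs_sgn mult.assoc[symmetric])
    qed simp
    also have "\<dots> = F (\<lambda>x. w x * (sgn (g x) * f x)) / c"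
      using F_eq[OF sf sf_le] by simp
    also have "\<dots> \<le> P.lux (\<lambda>x. w x * (sgn (g x) * f x))"
      using bound_c[OF wsf] c by (simp add: divide_le_eq mult.commute)
    also have "\<dots> \<le> P.lux (\<lambda>x. w x * f x)"
    proof (rule P.lux_mono[OF wf P.L_measurable[OF wsf]])
      show "AE x in \<mu>. \<bar>w x * (sgn (g x) * f x)\<bar> \<le> \<bar>w x * f x\<bar>"
        by (auto simp: abs_mult sgn_if)
    qed
    also have "\<dots> \<le> 1 + P.modu (\<lambda>x. w x * f x)"
      by (rule P.lux_le_modu[OF wf])
    finally show "(\<integral>x. w x * \<bar>v x / c\<bar> * f x \<partial>\<mu>) \<le> 1 + P.modu (\<lambda>x. w x * f x)" .
  qed
  from Q.L_scale[OF this, of c] have vL: "v \<in> Q.L" using c by simp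
  moreover have "F u = (\<integral>x. u x * v x \<partial>\<mu>)" if u: "u \<in> P.L" for u
  proof -
    \<comment> \<open>Cutting off by the size of \<open>u / w\<close> makes \<open>f n\<close>
      bounded, keeps \<open>\<bar>w * f n\<bar>\<close> below \<open>\<bar>u\<bar>\<close>, and at
      each point of the space leaves \<open>w * f n\<close> equal to \<open>u\<close> from some
      \<open>n\<close> on.\<close>
    define f where "f n x = (if \<bar>u x / w x\<bar> \<le> real n then u x / w x else 0)" for n x
    have f_meas: "f n \<in> borel_measurable \<mu>" for n
      unfolding f_def using P.L_measurable[OF u] P.L_measurable[OF w(1)] by measurable
    have f_bound: "\<bar>f n x\<bar> \<le> real n" for n x
      by (simp add: f_def)
    have wf: "w x * f n x = (if \<bar>u x / w x\<bar> \<le> real n then u x else 0)" if "x \<in> space \<mu>" for n x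
      using w(2)[OF that] by (simp add: f_def)
    have f_lim: "(\<lambda>n. w x * f n x) \<longlonglongrightarrow> u x" if x: "x \<in> space \<mu>" for x
    proof (rule tendsto_eventually)
      obtain N :: nat where N: "\<bar>u x / w x\<bar> \<le> real N"
        using real_arch_simple by blast
      have "w x * f n x = u x" if "n \<ge> N" for n
        using N that by (auto simp: wf[OF x])
      then show "\<forall>\<^sub>F n in sequentially. w x * f n x = u x"
        by (auto simp: eventually_sequentially)
    qed
    have "(\<lambda>n. F (\<lambda>x. w x * f n x)) \<longlonglongrightarrow> F u"
    proof (rule B.F_order_continuous(2)[OF u])
      show "(\<lambda>x. w x * f n x) \<in> borel_measurable \<mu>" for n
        using f_meas P.L_measurable[OF w(1)] by simp
      show "u \<in> borel_measurable \<mu>" by (rule P.L_measurable[OF u])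
      show "AE x in \<mu>. \<bar>w x * f n x\<bar> \<le> \<bar>u x\<bar>" for n
        by (rule AE_I2) (simp add: wf)
      show "AE x in \<mu>. (\<lambda>n. w x * f n x) \<longlonglongrightarrow> u x"
        by (rule AE_I2) (rule f_lim)
    qed
    moreover have "F (\<lambda>x. w x * f n x) = (\<integral>x. w x * f n x * v x \<partial>\<mu>)" for n
    proof -
      have "F (\<lambda>x. w x * f n x) = (\<integral>x. g x * f n x \<partial>\<mu>)"
        by (rule F_eq[OF f_meas f_bound])
      also have "\<dots> = (\<integral>x. w x * f n x * v x \<partial>\<mu>)"
        by (rule Bochner_Integration.integral_cong) (simp_all add: wv[symmetric] mult_ac)
      finally show ?thesis .
    qed
    moreover have "(\<lambda>n. \<integral>x. w x * f n x * v x \<partial>\<mu>) \<longlonglongrightarrow> (\<integral>x. u x * v x \<partial>\<mu>)"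
    proof (rule integral_dominated_convergence)
      show "integrable \<mu> (\<lambda>x. \<bar>u x * v x\<bar>)"
        using integrable_mult[OF u vL] by (rule integrable_abs)
      show "(\<lambda>x. w x * f n x * v x) \<in> borel_measurable \<mu>" for n
        using f_meas P.L_measurable[OF w(1)] v_meas by simp
      show "(\<lambda>x. u x * v x) \<in> borel_measurable \<mu>"
        using P.L_measurable[OF u] v_meas by simp
      show "AE x in \<mu>. (\<lambda>n. w x * f n x * v x) \<longlonglongrightarrow> u x * v x"
        by (rule AE_I2) (intro tendsto_mult f_lim tendsto_const)
      show "AE x in \<mu>. norm (w x * f n x * v x) \<le> \<bar>u x * v x\<bar>" for n
        by (rule AE_I2) (simp add: wf)
    qed
    ultimately show ?thesis using LIMSEQ_unique by simp
  qed
  ultimately show ?thesis by blast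
qed

end

section \<open>Dual spaces and the quotient by almost everywhere equality\<close>

lemma dual_space_simps:
  "carrier (dual_space X) = bounded_functionals X"
  "f \<oplus>\<^bsub>dual_space X\<^esub> g = (\<lambda>x\<in>carrier X. f x + g x)"
  "a \<odot>\<^bsub>dual_space X\<^esub> f = (\<lambda>x\<in>carrier X. a * f x)"
  "vnorm (dual_space X) f = (SUP x\<in>{x \<in> carrier X. vnorm X x \<le> 1}. \<bar>f x\<bar>)"
  by (simp_all add: dual_space_def)

lemma bounded_functionalsI:
  assumes "f \<in> extensional (carrier X)"
    and "\<And>x y. x \<in> carrier X \<Longrightarrow> y \<in> carrier X \<Longrightarrow> f (x \<oplus>\<^bsub>X\<^esub> y) = f x + f y"
    and "\<And>a x. x \<in> carrier X \<Longrightarrow> f (a \<odot>\<^bsub>X\<^esub> x) = a * f x"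
    and "\<And>x. x \<in> carrier X \<Longrightarrow> \<bar>f x\<bar> \<le> C * vnorm X x"
  shows "f \<in> bounded_functionals X"
  using assms unfolding bounded_functionals_def by blast

lemma bounded_functionalsD:
  assumes "f \<in> bounded_functionals X"
  shows "f \<in> extensional (carrier X)"
    and "\<And>x y. x \<in> carrier X \<Longrightarrow> y \<in> carrier X \<Longrightarrow> f (x \<oplus>\<^bsub>X\<^esub> y) = f x + f y"
    and "\<And>a x. x \<in> carrier X \<Longrightarrow> f (a \<odot>\<^bsub>X\<^esub> x) = a * f x"
    and "\<exists>C. \<forall>x\<in>carrier X. \<bar>f x\<bar> \<le> C * vnorm X x"
  using assms unfolding bounded_functionals_def by auto

lemma normed_space_closed:
  assumes "normed_space X"
  shows "\<And>x y. x \<in> carrier X \<Longrightarrow> y \<in> carrier X \<Longrightarrow> x \<oplus>\<^bsub>X\<^esub> y \<in> carrier X"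
    and "\<And>a x. x \<in> carrier X \<Longrightarrow> a \<odot>\<^bsub>X\<^esub> x \<in> carrier X"
    and "\<zero>\<^bsub>X\<^esub> \<in> carrier X"
proof -
  interpret module real_ring X using assms by (simp add: normed_space_def)
  show "\<And>x y. x \<in> carrier X \<Longrightarrow> y \<in> carrier X \<Longrightarrow> x \<oplus>\<^bsub>X\<^esub> y \<in> carrier X"
    and "\<zero>\<^bsub>X\<^esub> \<in> carrier X"
    by auto
  show "\<And>a x. x \<in> carrier X \<Longrightarrow> a \<odot>\<^bsub>X\<^esub> x \<in> carrier X"
    by (rule smult_closed) (simp_all add: real_ring_def)
qed

lemma normed_spaceD:
  assumes "normed_space X" "x \<in> carrier X"
  shows "0 \<le> vnorm X x" "vnorm X x = 0 \<longleftrightarrow> x = \<zero>\<^bsub>X\<^esub>"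
    "vnorm X (a \<odot>\<^bsub>X\<^esub> x) = \<bar>a\<bar> * vnorm X x"
  using assms unfolding normed_space_def by auto

lemma dual_norm_le:
  assumes X: "normed_space X" and "0 \<le> c"
    and f: "\<And>x. x \<in> carrier X \<Longrightarrow> \<bar>f x\<bar> \<le> c * vnorm X x"
  shows "vnorm (dual_space X) f \<le> c"
  unfolding dual_space_simps
proof (rule cSUP_least)
  have "vnorm X \<zero>\<^bsub>X\<^esub> = 0"
    using normed_spaceD(2)[OF X normed_space_closed(3)[OF X]] by simp
  then show "{x \<in> carrier X. vnorm X x \<le> 1} \<noteq> {}"
    using normed_space_closed(3)[OF X] by auto
  fix x assume "x \<in> {x \<in> carrier X. vnorm X x \<le> 1}"
  then have "x \<in> carrier X" "c * vnorm X x \<le> c * 1"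
    using \<open>0 \<le> c\<close> mult_left_mono[of "vnorm X x" 1 c] by auto
  then show "\<bar>f x\<bar> \<le> c" using f[of x] by simp
qed

lemma dual_norm_upper:
  assumes X: "normed_space X" and f: "f \<in> bounded_functionals X"
    and y: "y \<in> carrier X" "vnorm X y \<le> 1"
  shows "\<bar>f y\<bar> \<le> vnorm (dual_space X) f"
proof -
  obtain C where C: "\<And>x. x \<in> carrier X \<Longrightarrow> \<bar>f x\<bar> \<le> C * vnorm X x"
    using bounded_functionalsD(4)[OF f] by blast
  have "bdd_above ((\<lambda>x. \<bar>f x\<bar>) ` {x \<in> carrier X. vnorm X x \<le> 1})"
  proof (rule bdd_aboveI2)
    fix z assume z: "z \<in> {x \<in> carrier X. vnorm X x \<le> 1}"
    then have "\<bar>f z\<bar> \<le> C * vnorm X z" using C by simp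
    also have "\<dots> \<le> \<bar>C\<bar> * vnorm X z"
      using z normed_spaceD(1)[OF X, of z] by (intro mult_right_mono) auto
    also have "\<dots> \<le> \<bar>C\<bar> * 1"
      using z by (intro mult_left_mono) auto
    finally show "\<bar>f z\<bar> \<le> \<bar>C\<bar>" by simp
  qed
  then show ?thesis
    unfolding dual_space_simps by (rule cSUP_upper[rotated]) (use y in simp)
qed

lemma dual_norm_nonneg:
  assumes X: "normed_space X" and f: "f \<in> bounded_functionals X"
  shows "0 \<le> vnorm (dual_space X) f"
proof -
  have "vnorm X \<zero>\<^bsub>X\<^esub> \<le> 1"
    using normed_spaceD(2)[OF X normed_space_closed(3)[OF X]] by simp
  from dual_norm_upper[OF X f normed_space_closed(3)[OF X] this] show ?thesis by linarith
qed

lemma dual_norm_bound: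
  assumes X: "normed_space X" and f: "f \<in> bounded_functionals X" and x: "x \<in> carrier X"
  shows "\<bar>f x\<bar> \<le> vnorm (dual_space X) f * vnorm X x"
proof -
  obtain C where C: "\<And>x. x \<in> carrier X \<Longrightarrow> \<bar>f x\<bar> \<le> C * vnorm X x"
    using bounded_functionalsD(4)[OF f] by blast
  show ?thesis
  proof (cases "vnorm X x = 0")
    case True
    then show ?thesis using C[OF x] by simp
  next
    case False
    define n where "n = vnorm X x"
    have n: "0 < n" using False normed_spaceD(1)[OF X x] by (simp add: n_def)
    define y where "y = (1 / n) \<odot>\<^bsub>X\<^esub> x"
    have y: "y \<in> carrier X" "vnorm X y \<le> 1"
      using normed_space_closed(2)[OF X x] normed_spaceD(3)[OF X x, of "1 / n"] n
      by (simp_all add: y_def n_def[symmetric])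
    have "\<bar>f y\<bar> \<le> vnorm (dual_space X) f"
      by (rule dual_norm_upper[OF X f y])
    moreover have "f y = f x / n"
      using bounded_functionalsD(3)[OF f x, of "1 / n"] by (simp add: y_def)
    ultimately show ?thesis
      using n by (simp add: n_def[symmetric] abs_divide pos_divide_le_eq)
  qed
qed

text \<open>The embedding is restricted to the carrier of the dual, so its linearity can be
  evaluated only once sums and multiples of bounded functionals are known to stay in that
  carrier.\<close>

lemma canonical_embedding_in_bidual:
  assumes X: "normed_space X" and x: "x \<in> carrier X"
  shows "canonical_embedding X x \<in> carrier (dual_space (dual_space X))"
proof -
  have add: "(\<lambda>x\<in>carrier X. f x + g x) \<in> bounded_functionals X"
    if f: "f \<in> bounded_functionals X" and g: "g \<in> bounded_functionals X" for f g
  proof (rule bounded_functionalsI)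
    fix y assume y: "y \<in> carrier X"
    show "\<bar>(\<lambda>x\<in>carrier X. f x + g x) y\<bar> \<le>
        (vnorm (dual_space X) f + vnorm (dual_space X) g) * vnorm X y"
      using dual_norm_bound[OF X f y] dual_norm_bound[OF X g y] y by (simp add: distrib_right)
  qed (use bounded_functionalsD[OF f] bounded_functionalsD[OF g] normed_space_closed[OF X]
      in \<open>simp_all add: distrib_left\<close>)
  have smult: "(\<lambda>x\<in>carrier X. a * f x) \<in> bounded_functionals X"
    if f: "f \<in> bounded_functionals X" for f a
  proof (rule bounded_functionalsI)
    fix y assume y: "y \<in> carrier X"
    show "\<bar>(\<lambda>x\<in>carrier X. a * f x) y\<bar> \<le> (\<bar>a\<bar> * vnorm (dual_space X) f) * vnorm X y"
      using dual_norm_bound[OF X f y] y by (simp add: abs_mult mult.assoc mult_left_mono)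
  qed (use bounded_functionalsD[OF f] normed_space_closed[OF X] in \<open>simp_all add: distrib_left\<close>)
  have "canonical_embedding X x \<in> bounded_functionals (dual_space X)"
  proof (rule bounded_functionalsI)
    show "\<bar>canonical_embedding X x f\<bar> \<le> vnorm X x * vnorm (dual_space X) f"
      if "f \<in> carrier (dual_space X)" for f
      using that dual_norm_bound[OF X _ x, of f]
      by (simp add: canonical_embedding_def dual_space_simps(1) mult.commute)
  qed (simp_all add: canonical_embedding_def dual_space_simps(1-3) add smult x)
  then show ?thesis by (simp add: dual_space_simps(1))
qed

lemma reflexive_spaceI:
  assumes X: "normed_space X"
    and onto: "\<And>T. T \<in> bounded_functionals (dual_space X) \<Longrightarrow>
      \<exists>x\<in>carrier X. \<forall>f\<in>bounded_functionals X. T f = f x"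
  shows "reflexive_space X"
  unfolding reflexive_space_def
proof (intro conjI X equalityI subsetI)
  fix T assume "T \<in> canonical_embedding X ` carrier X"
  then show "T \<in> carrier (dual_space (dual_space X))"
    using canonical_embedding_in_bidual[OF X] by auto
next
  fix T assume "T \<in> carrier (dual_space (dual_space X))"
  then have T: "T \<in> bounded_functionals (dual_space X)"
    by (simp add: dual_space_simps)
  then obtain x where x: "x \<in> carrier X" "\<And>f. f \<in> bounded_functionals X \<Longrightarrow> T f = f x"
    using onto by blast
  have "T = canonical_embedding X x"
    using bounded_functionalsD(1)[OF T] x(2)
    by (intro extensionalityI[where A = "bounded_functionals X"])
      (auto simp: canonical_embedding_def dual_space_simps(1))
  then show "T \<in> canonical_embedding X ` carrier X" using x(1) by blast
qed

lemma cring_real_ring: "cring real_ring"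
proof (rule cringI)
  show "abelian_group real_ring"
    by (rule abelian_groupI)
      (auto simp: real_ring_def algebra_simps intro!: exI[of _ "- x" for x :: real])
  show "comm_monoid real_ring"
    by (rule comm_monoidI) (auto simp: real_ring_def)
qed (auto simp: real_ring_def distrib_right)

section \<open>The Musielak-Orlicz space as a normed module\<close>

text \<open>The exceptional null set in \<open>M_eq\<close> does not depend on \<open>s\<close>, so
  the equation may be used at the varying argument \<open>\<bar>u x\<bar> / l\<close>.\<close>

locale MO_complementary = complementary_integrands "lebesgue_on \<Omega>" \<Phi> \<Psi>
  for \<Omega> :: "(real ^ 'n) set" and \<Phi> \<Psi> +
  fixes M :: "real ^ 'n \<Rightarrow> real \<Rightarrow> ennreal"
  assumes M_eq: "AE x in lebesgue_on \<Omega>. \<forall>s\<ge>0. M x s = ennreal (\<Phi> x s)"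
begin

lemma modular_eq:
  assumes "0 < l"
  shows "modular \<Omega> M u l = (\<integral>\<^sup>+x. ennreal (\<Phi> x \<bar>u x / l\<bar>) \<partial>lebesgue_on \<Omega>)"
  unfolding modular_def
proof (rule nn_integral_cong_AE)
  show "AE x in lebesgue_on \<Omega>. M x (\<bar>u x\<bar> / l) = ennreal (\<Phi> x \<bar>u x / l\<bar>)"
    using M_eq by eventually_elim (use assms in \<open>simp add: abs_divide\<close>)
qed

lemma MO_functions_eq: "MO_functions \<Omega> M = P.L"
proof (intro equalityI subsetI)
  fix u assume u: "u \<in> P.L"
  then have "(\<integral>\<^sup>+x. ennreal (\<Phi> x \<bar>u x / 1\<bar>) \<partial>lebesgue_on \<Omega>) < \<infinity>"
    using P.L_integrable[OF u] P.\<Phi>_nonneg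
    by (subst nn_integral_eq_integral) auto
  then show "u \<in> MO_functions \<Omega> M"
    using P.L_measurable[OF u] modular_eq[of 1 u] unfolding MO_functions_def
    by (auto intro!: exI[of _ 1])
next
  fix u assume "u \<in> MO_functions \<Omega> M"
  then obtain l where u: "u \<in> borel_measurable (lebesgue_on \<Omega>)" and l: "0 < l"
    "(\<integral>\<^sup>+x. ennreal (\<Phi> x \<bar>u x / l\<bar>) \<partial>lebesgue_on \<Omega>) < \<infinity>"
    unfolding MO_functions_def using modular_eq by auto
  have meas: "(\<lambda>x. u x / l) \<in> borel_measurable (lebesgue_on \<Omega>)" using u by simp
  have "integrable (lebesgue_on \<Omega>) (\<lambda>x. \<Phi> x \<bar>u x / l\<bar>)"
  proof (rule integrableI_nonneg[OF P.borel_measurable_\<Phi>_abs[OF meas] _ l(2)])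
    show "AE x in lebesgue_on \<Omega>. 0 \<le> \<Phi> x \<bar>u x / l\<bar>"
      by (rule AE_I2) (rule P.\<Phi>_nonneg, simp_all)
  qed
  then have "(\<lambda>x. u x / l) \<in> P.L"
    using meas by (simp add: P.L_def)
  from P.L_scale[OF this, of l] show "u \<in> P.L" using l(1) by simp
qed

lemma luxemburg_norm_eq:
  assumes u: "u \<in> P.L"
  shows "luxemburg_norm \<Omega> M u = P.lux u"
proof -
  have "modular \<Omega> M u l = ennreal (P.modu (\<lambda>x. u x / l))" if "0 < l" for l
    unfolding modular_eq[OF that] P.modu_def
    using P.L_integrable[OF P.L_divide[OF u]] P.\<Phi>_nonneg by (intro nn_integral_eq_integral) auto
  then have "{l. 0 < l \<and> modular \<Omega> M u l \<le> 1} = {l. 0 < l \<and> P.modu (\<lambda>x. u x / l) \<le> 1}"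
    by (auto simp flip: ennreal_1)
  then show ?thesis by (simp add: luxemburg_norm_def P.lux_def)
qed

text \<open>The function \<open>u\<close> itself is not asked to lie in the space; thus almost
  everywhere equality alone gives equality of classes.\<close>

definition cls :: "(real ^ 'n \<Rightarrow> real) \<Rightarrow> (real ^ 'n \<Rightarrow> real) set" where
  "cls u = {v \<in> P.L. AE x in lebesgue_on \<Omega>. u x = v x}"

abbreviation X :: "(real ^ 'n \<Rightarrow> real) set normed_module" where
  "X \<equiv> MO_space \<Omega> M"

lemma MO_rel_Image: "u \<in> P.L \<Longrightarrow> MO_rel \<Omega> M `` {u} = cls u"
  by (auto simp: MO_rel_def MO_functions_eq cls_def)

lemma in_cls: "u \<in> P.L \<Longrightarrow> u \<in> cls u"
  by (simp add: cls_def)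

lemma cls_eqI:
  assumes "AE x in lebesgue_on \<Omega>. u x = v x"
  shows "cls u = cls v"
proof -
  have "(AE x in lebesgue_on \<Omega>. u x = z x) \<longleftrightarrow> (AE x in lebesgue_on \<Omega>. v x = z x)" for z
    using assms by (auto elim!: AE_mp)
  then show ?thesis by (simp add: cls_def)
qed

lemma cls_eq_iff:
  assumes "u \<in> P.L" "v \<in> P.L"
  shows "cls u = cls v \<longleftrightarrow> (AE x in lebesgue_on \<Omega>. u x = v x)"
  using cls_eqI in_cls[OF assms(2)] by (auto simp: cls_def)

lemma carrier_X: "carrier X = cls ` P.L"
  by (auto simp: MO_space_def quotient_def MO_functions_eq MO_rel_Image)

text \<open>Every choice of representatives contributes the same class, so the double union
  collapses to it; both classes are nonempty.\<close>

lemma add_X: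
  assumes u: "u \<in> P.L" and v: "v \<in> P.L"
  shows "cls u \<oplus>\<^bsub>X\<^esub> cls v = cls (\<lambda>x. u x + v x)"
proof -
  have "MO_rel \<Omega> M `` {\<lambda>x. u' x + v' x} = cls (\<lambda>x. u x + v x)"
    if u': "u' \<in> cls u" and v': "v' \<in> cls v" for u' v'
  proof -
    have "AE x in lebesgue_on \<Omega>. u x = u' x" "AE x in lebesgue_on \<Omega>. v x = v' x"
      using u' v' by (auto simp: cls_def)
    then have "AE x in lebesgue_on \<Omega>. u' x + v' x = u x + v x"
      by eventually_elim simp
    then have "cls (\<lambda>x. u' x + v' x) = cls (\<lambda>x. u x + v x)"
      by (rule cls_eqI)
    then show ?thesis
      using u' v' by (simp add: MO_rel_Image P.L_add cls_def)
  qed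
  then show ?thesis
    using in_cls[OF u] in_cls[OF v] by (auto simp: MO_space_def)
qed

lemma smult_X:
  assumes u: "u \<in> P.L"
  shows "a \<odot>\<^bsub>X\<^esub> cls u = cls (\<lambda>x. a * u x)"
proof -
  have "MO_rel \<Omega> M `` {\<lambda>x. a * u' x} = cls (\<lambda>x. a * u x)" if u': "u' \<in> cls u" for u'
  proof -
    have "AE x in lebesgue_on \<Omega>. u x = u' x"
      using u' by (auto simp: cls_def)
    then have "AE x in lebesgue_on \<Omega>. a * u' x = a * u x"
      by eventually_elim simp
    then have "cls (\<lambda>x. a * u' x) = cls (\<lambda>x. a * u x)"
      by (rule cls_eqI)
    then show ?thesis
      using u' by (simp add: MO_rel_Image P.L_scale cls_def)
  qed
  then show ?thesis
    using in_cls[OF u] by (auto simp: MO_space_def)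
qed

lemma zero_X: "\<zero>\<^bsub>X\<^esub> = cls (\<lambda>x. 0)"
  by (simp add: MO_space_def MO_rel_Image P.L_zero)

lemma vnorm_X:
  assumes u: "u \<in> P.L"
  shows "vnorm X (cls u) = P.lux u"
proof -
  have "luxemburg_norm \<Omega> M v = P.lux u" if "v \<in> cls u" for v
    using that u luxemburg_norm_eq[of v] P.lux_cong[of u v] by (auto simp: cls_def)
  then have "luxemburg_norm \<Omega> M ` cls u = {P.lux u}"
    using in_cls[OF u] by (auto simp: image_iff)
  then show ?thesis by (simp add: MO_space_def)
qed

lemma normed_space_X: "normed_space X"
proof -
  have "abelian_group X"
  proof (rule abelian_groupI, goal_cases)
    \<comment> \<open>The existence of an additive inverse is the one group axiom that needs a
      witness.\<close>
    case (6 x)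
    then obtain u where u: "u \<in> P.L" "x = cls u" by (auto simp: carrier_X)
    have "cls (\<lambda>x. (- 1) * u x) \<oplus>\<^bsub>X\<^esub> x = \<zero>\<^bsub>X\<^esub>"
      unfolding u(2) add_X[OF P.L_scale[OF u(1)] u(1)] by (simp add: zero_X)
    then show ?case using P.L_scale[OF u(1), of "- 1"] by (auto simp: carrier_X)
  qed (auto simp: carrier_X add_X zero_X P.L_add P.L_zero add_ac)
  then have "module real_ring X"
    by (intro moduleI cring_real_ring)
      (auto simp: carrier_X add_X smult_X P.L_add P.L_scale real_ring_def algebra_simps)
  moreover have "vnorm X (cls u) = 0 \<longleftrightarrow> cls u = \<zero>\<^bsub>X\<^esub>" if "u \<in> P.L" for u
    using that by (simp add: vnorm_X zero_X cls_eq_iff P.L_zero P.lux_eq_zero_iff)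
  ultimately show ?thesis
    unfolding normed_space_def
    by (auto simp: carrier_X add_X smult_X P.L_add P.L_scale vnorm_X P.lux_nonneg P.lux_scale P.lux_add)
qed

section \<open>The pairing with the complementary space\<close>

definition pairing :: "(real ^ 'n \<Rightarrow> real) \<Rightarrow> (real ^ 'n \<Rightarrow> real) set \<Rightarrow> real" where
  "pairing v = (\<lambda>U\<in>carrier X. \<integral>x. (SOME u. u \<in> U) x * v x \<partial>lebesgue_on \<Omega>)"

lemma pairing_cls:
  assumes u: "u \<in> P.L" and v: "v \<in> Q.L"
  shows "pairing v (cls u) = (\<integral>x. u x * v x \<partial>lebesgue_on \<Omega>)"
proof -
  define u' where "u' = (SOME u'. u' \<in> cls u)"
  have "u' \<in> cls u" using someI[of "\<lambda>u'. u' \<in> cls u", OF in_cls[OF u]] by (simp add: u'_def)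
  then have u': "u' \<in> P.L" "AE x in lebesgue_on \<Omega>. u x = u' x"
    by (auto simp: cls_def)
  have "(\<integral>x. u' x * v x \<partial>lebesgue_on \<Omega>) = (\<integral>x. u x * v x \<partial>lebesgue_on \<Omega>)"
  proof (rule integral_cong_AE)
    show "AE x in lebesgue_on \<Omega>. u' x * v x = u x * v x"
      using u'(2) by eventually_elim simp
  qed (use u'(1) u v P.L_measurable Q.L_measurable in simp_all)
  then show ?thesis
    using u by (auto simp: pairing_def carrier_X u'_def)
qed

text \<open>Both parts come from Hoelder's inequality. The norm estimate is what makes
  \<open>T (pairing v)\<close> a bounded functional of \<open>v\<close> for every \<open>T\<close>
  in the bidual.\<close>

lemma pairing_bounded:
  assumes v: "v \<in> Q.L"
  shows "pairing v \<in> bounded_functionals X"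
    and "vnorm (dual_space X) (pairing v) \<le> 2 * Q.lux v"
proof -
  have le: "\<bar>pairing v U\<bar> \<le> 2 * Q.lux v * vnorm X U" if "U \<in> carrier X" for U
    using that hoelder[OF _ v] by (auto simp: carrier_X pairing_cls v vnorm_X mult_ac)
  show "pairing v \<in> bounded_functionals X"
  proof (rule bounded_functionalsI[OF _ _ _ le])
    show "pairing v \<in> extensional (carrier X)" by (simp add: pairing_def)
    fix U V assume "U \<in> carrier X" "V \<in> carrier X"
    then show "pairing v (U \<oplus>\<^bsub>X\<^esub> V) = pairing v U + pairing v V"
      using integrable_mult[OF _ v]
      by (auto simp: carrier_X add_X pairing_cls v P.L_add distrib_right)
  next
    fix a U assume "U \<in> carrier X"
    then show "pairing v (a \<odot>\<^bsub>X\<^esub> U) = a * pairing v U"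
      by (auto simp: carrier_X smult_X pairing_cls v P.L_scale mult.assoc)
  qed
  show "vnorm (dual_space X) (pairing v) \<le> 2 * Q.lux v"
    using le Q.lux_nonneg[OF v] by (intro dual_norm_le normed_space_X) auto
qed

text \<open>Composed with \<open>cls\<close>, the functional acts on functions and the
  representation theorem applies; extensionality then identifies it with \<open>pairing v\<close>
  itself.\<close>

lemma pairing_onto:
  assumes f: "f \<in> bounded_functionals X"
  shows "\<exists>v\<in>Q.L. f = pairing v"
proof -
  obtain C where C: "\<And>U. U \<in> carrier X \<Longrightarrow> \<bar>f U\<bar> \<le> C * vnorm X U"
    using bounded_functionalsD(4)[OF f] by blast
  have "\<exists>v\<in>Q.L. \<forall>u\<in>P.L. f (cls u) = (\<integral>x. u x * v x \<partial>lebesgue_on \<Omega>)"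
  proof (rule dual_representation[where C = C])
    fix u v assume "u \<in> P.L" "v \<in> P.L"
    then show "f (cls (\<lambda>x. u x + v x)) = f (cls u) + f (cls v)"
      using bounded_functionalsD(2)[OF f, of "cls u" "cls v"] by (simp add: carrier_X add_X)
  next
    fix a u assume "u \<in> P.L"
    then show "f (cls (\<lambda>x. a * u x)) = a * f (cls u)"
      using bounded_functionalsD(3)[OF f, of "cls u" a] by (simp add: carrier_X smult_X)
  next
    fix u assume "u \<in> P.L"
    then show "\<bar>f (cls u)\<bar> \<le> C * P.lux u"
      using C[of "cls u"] by (simp add: carrier_X vnorm_X)
  qed
  then obtain v where v: "v \<in> Q.L"
    "\<And>u. u \<in> P.L \<Longrightarrow> f (cls u) = (\<integral>x. u x * v x \<partial>lebesgue_on \<Omega>)" by blast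
  have "f = pairing v"
  proof (rule extensionalityI)
    show "f \<in> extensional (carrier X)" by (rule bounded_functionalsD(1)[OF f])
    show "pairing v \<in> extensional (carrier X)" by (simp add: pairing_def)
    fix U assume "U \<in> carrier X"
    then show "f U = pairing v U" by (auto simp: carrier_X pairing_cls v)
  qed
  then show ?thesis using v(1) by blast
qed

theorem reflexive_X: "reflexive_space X"
proof (rule reflexive_spaceI[OF normed_space_X])
  fix T assume T: "T \<in> bounded_functionals (dual_space X)"
  obtain C where C: "\<And>f. f \<in> bounded_functionals X \<Longrightarrow> \<bar>T f\<bar> \<le> C * vnorm (dual_space X) f"
    using bounded_functionalsD(4)[OF T] by (auto simp: dual_space_simps(1))
  interpret S: complementary_integrands "lebesgue_on \<Omega>" \<Psi> \<Phi> by (rule swap)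
  have "\<exists>u\<in>P.L. \<forall>v\<in>Q.L. T (pairing v) = (\<integral>x. v x * u x \<partial>lebesgue_on \<Omega>)"
  \<comment> \<open>The 2 is the constant of \<open>pairing_bounded\<close>; the absolute value is
    needed because \<open>C\<close> may be negative.\<close>
  proof (rule S.dual_representation[where C = "2 * \<bar>C\<bar>"])
    fix v v' assume v: "v \<in> Q.L" "v' \<in> Q.L"
    have "pairing (\<lambda>x. v x + v' x) = pairing v \<oplus>\<^bsub>dual_space X\<^esub> pairing v'"
      unfolding dual_space_simps
    proof (rule extensionalityI)
      fix U assume "U \<in> carrier X"
      then obtain u where u: "u \<in> P.L" "U = cls u" by (auto simp: carrier_X)
      show "pairing (\<lambda>x. v x + v' x) U = (\<lambda>x\<in>carrier X. pairing v x + pairing v' x) U"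
        using u v integrable_mult[OF u(1) v(1)] integrable_mult[OF u(1) v(2)] \<open>U \<in> carrier X\<close>
        by (simp add: pairing_cls Q.L_add distrib_left)
    qed (auto simp: pairing_def)
    then show "T (pairing (\<lambda>x. v x + v' x)) = T (pairing v) + T (pairing v')"
      using bounded_functionalsD(2)[OF T] pairing_bounded(1) v by (simp add: dual_space_simps(1))
  next
    fix a v assume v: "v \<in> Q.L"
    have "pairing (\<lambda>x. a * v x) = a \<odot>\<^bsub>dual_space X\<^esub> pairing v"
      unfolding dual_space_simps
    proof (rule extensionalityI)
      fix U assume "U \<in> carrier X"
      then obtain u where u: "u \<in> P.L" "U = cls u" by (auto simp: carrier_X)
      show "pairing (\<lambda>x. a * v x) U = (\<lambda>x\<in>carrier X. a * pairing v x) U"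
        using u v \<open>U \<in> carrier X\<close> by (simp add: pairing_cls Q.L_scale mult.left_commute)
    qed (auto simp: pairing_def)
    then show "T (pairing (\<lambda>x. a * v x)) = a * T (pairing v)"
      using bounded_functionalsD(3)[OF T] pairing_bounded(1) v by (simp add: dual_space_simps(1))
  next
    fix v assume v: "v \<in> Q.L"
    have "\<bar>T (pairing v)\<bar> \<le> C * vnorm (dual_space X) (pairing v)"
      by (rule C[OF pairing_bounded(1)[OF v]])
    also have "\<dots> \<le> \<bar>C\<bar> * vnorm (dual_space X) (pairing v)"
      by (intro mult_right_mono dual_norm_nonneg normed_space_X pairing_bounded(1) v) simp
    also have "\<dots> \<le> \<bar>C\<bar> * (2 * Q.lux v)"
      by (intro mult_left_mono pairing_bounded v) auto
    finally show "\<bar>T (pairing v)\<bar> \<le> 2 * \<bar>C\<bar> * Q.lux v" by simp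
  qed
  then obtain u where u: "u \<in> P.L"
    "\<And>v. v \<in> Q.L \<Longrightarrow> T (pairing v) = (\<integral>x. v x * u x \<partial>lebesgue_on \<Omega>)" by blast
  \<comment> \<open>So far \<open>T\<close> is known on functionals of the form
    \<open>pairing v\<close>; by \<open>pairing_onto\<close> these are all.\<close>
  have "T f = f (cls u)" if "f \<in> bounded_functionals X" for f
  proof -
    obtain v where v: "v \<in> Q.L" "f = pairing v"
      using pairing_onto[OF \<open>f \<in> bounded_functionals X\<close>] by blast
    then show ?thesis by (simp add: u pairing_cls mult.commute)
  qed
  then show "\<exists>x\<in>carrier X. \<forall>f\<in>bounded_functionals X. T f = f x"
    using u(1) by (auto simp: carrier_X)
qed

end

section \<open>Reduction to finite integrands\<close>

lemma sigma_finite_completion: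
  assumes "sigma_finite_measure M"
  shows "sigma_finite_measure (completion M)"
proof -
  obtain A where A: "countable A" "A \<subseteq> sets M" "\<Union>A = space M" "\<And>a. a \<in> A \<Longrightarrow> emeasure M a \<noteq> \<infinity>"
    using sigma_finite_measure.sigma_finite_countable[OF assms] by blast
  show ?thesis
  proof (rule sigma_finite_measure.intro, intro exI[of _ A] conjI ballI)
    fix a assume "a \<in> A"
    then have "a \<in> sets M" using A(2) by blast
    then show "emeasure (completion M) a \<noteq> \<infinity>"
      using A(4)[OF \<open>a \<in> A\<close>] by simp
  qed (use A in auto)
qed

text \<open>The limit of \<open>M x s / s\<close> at 0 provides one \<open>r > 0\<close> with a
  finite value, Delta2 carries finiteness to all \<open>2 ^ n * r\<close>, and monotonicity fills
  the gaps.\<close>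

lemma Phi_function_finite:
  assumes Phi: "Phi_function \<Omega> M" and x: "x \<in> \<Omega>"
    and Delta2: "\<And>t. 0 \<le> t \<Longrightarrow> M x (2 * t) \<le> ennreal k * M x t + ennreal h"
    and s: "0 \<le> s"
  shows "M x s < \<infinity>"
proof -
  have "\<forall>\<^sub>F s in at_right 0. M x s / ennreal s < 1"
    using Phi x by (intro order_tendstoD(2)[of _ 0]) (auto simp: Phi_function_def)
  then have "\<forall>\<^sub>F s in at_right 0. M x s / ennreal s < 1 \<and> 0 < s"
    by (intro eventually_conj eventually_at_right_less)
  then obtain r where r: "0 < r" "M x r / ennreal r < 1"
    using eventually_happens[of _ "at_right (0::real)"] trivial_limit_at_right_real by blast
  have pow: "M x (2 ^ n * r) < \<infinity>" for n
  proof (induction n)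
    case 0
    show ?case using r by (cases "M x r") (auto simp: ennreal_top_divide less_top)
  next
    case (Suc n)
    then have "ennreal k * M x (2 ^ n * r) + ennreal h < \<infinity>"
      by (simp add: ennreal_mult_less_top)
    then show ?case
      using Delta2[of "2 ^ n * r"] r(1) by (simp add: mult.assoc order.strict_trans1)
  qed
  obtain n where "s / r < 2 ^ n"
    using real_arch_pow[of 2 "s / r"] by auto
  then have "s \<le> 2 ^ n * r" using r(1) by (simp add: pos_divide_less_eq)
  moreover have "mono_on {0..} (M x)"
    using Phi x by (simp add: Phi_function_def phi_function_def)
  ultimately have "M x s \<le> M x (2 ^ n * r)"
    using s r(1) by (intro mono_onD[of "{0..}" "M x"]) auto
  then show ?thesis using pow[of n] by (rule le_less_trans)
qed

text \<open>The term at 0 vanishes, so the supremum is nonnegative and its conversion to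
  \<open>ennreal\<close> can be undone; what remains is that a supremum is the least upper
  bound.\<close>

lemma complementary_real:
  fixes \<phi> \<psi> :: "real \<Rightarrow> real"
  assumes M: "\<And>s. 0 \<le> s \<Longrightarrow> M x s = ennreal (\<phi> s)" and \<phi>: "\<And>s. 0 \<le> s \<Longrightarrow> 0 \<le> \<phi> s" "\<phi> 0 = 0"
    and C: "complementary M x t = ennreal \<psi>t" and \<psi>: "0 \<le> \<psi>t"
  shows "0 \<le> s \<Longrightarrow> s * t \<le> \<phi> s + \<psi>t"
    and "r < \<psi>t \<Longrightarrow> \<exists>s\<ge>0. r < s * t - \<phi> s"
proof -
  define S where "S = (SUP s\<in>{0..}. ereal (t * s) - enn2ereal (M x s))"
  have S_eq: "S = (SUP s\<in>{0..}. ereal (s * t - \<phi> s))"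
    unfolding S_def using \<phi> by (intro SUP_cong) (auto simp: M mult.commute)
  have le: "ereal (s * t - \<phi> s) \<le> S" if "0 \<le> s" for s
    unfolding S_eq by (rule SUP_upper) (use that in simp)
  have "0 \<le> S" using le[of 0] \<phi>(2) by (simp add: zero_ereal_def)
  moreover have "e2ennreal S = ennreal \<psi>t"
    using C by (simp add: complementary_def S_def)
  ultimately have S: "S = ereal \<psi>t"
    using enn2ereal_e2ennreal[of S] \<psi> by simp
  show "s * t \<le> \<phi> s + \<psi>t" if "0 \<le> s"
    using le[OF that] S by simp
  assume "r < \<psi>t"
  then have "ereal r < S" using S by simp
  then show "\<exists>s\<ge>0. r < s * t - \<phi> s"
    unfolding S_eq less_SUP_iff by auto
qed

text \<open>The Legendre transform is involutive here: the slope of a supporting line at \<open>s\<close> attains the supremum.\<close>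

lemma biconjugate_real:
  fixes \<phi> \<psi> :: "real \<Rightarrow> real"
  assumes convex: "convex_on {0..} \<phi>" and \<phi>: "\<And>s. 0 \<le> s \<Longrightarrow> 0 \<le> \<phi> s" "\<phi> 0 = 0"
    and least: "\<And>t r. 0 \<le> t \<Longrightarrow> r < \<psi> t \<Longrightarrow> \<exists>s\<ge>0. r < s * t - \<phi> s"
    and s: "0 \<le> s" and r: "r < \<phi> s"
  shows "\<exists>t\<ge>0. r < s * t - \<psi> t"
proof (cases "s = 0")
  case True
  have "\<psi> 0 \<le> 0"
  proof (rule ccontr)
    assume "\<not> \<psi> 0 \<le> 0"
    then obtain s' where "0 \<le> s'" "0 < s' * 0 - \<phi> s'" using least[of 0 0] by auto
    then show False using \<phi>(1)[of s'] by simp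
  qed
  then show ?thesis using True r \<phi>(2) by (intro exI[of _ 0]) auto
next
  case False
  \<comment> \<open>This infimum of difference quotients to the right of \<open>s\<close> is the
    slope of a supporting line, available because \<open>s > 0\<close> is interior to the half-line;
    comparing at 0 shows \<open>0 \<le> m\<close>.\<close>
  define m where "m = Inf ((\<lambda>t. (\<phi> s - \<phi> t) / (s - t)) ` ({s<..} \<inter> {0..}))"
  have m: "\<phi> s + m * (y - s) \<le> \<phi> y" if "0 \<le> y" for y
    unfolding m_def using False s that by (intro convex_le_Inf_differential[OF convex]) (auto simp: interior_real_atLeast)
  have "0 \<le> m * s" using m[of 0] \<phi>(1)[OF s] \<phi>(2) by simp
  then have m0: "0 \<le> m" using False s by (simp add: zero_le_mult_iff)
  have "\<psi> m \<le> s * m - \<phi> s"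
  proof (rule ccontr)
    assume "\<not> \<psi> m \<le> s * m - \<phi> s"
    then have "s * m - \<phi> s < \<psi> m" by simp
    then obtain y where y: "0 \<le> y" "s * m - \<phi> s < y * m - \<phi> y" using least[OF m0] by blast
    then show False using m[OF y(1)] by (simp add: algebra_simps)
  qed
  then show ?thesis using m0 r by (intro exI[of _ m]) auto
qed

lemma convex_on_enn2real:
  fixes f :: "real \<Rightarrow> ennreal"
  assumes fin: "\<And>s. 0 \<le> s \<Longrightarrow> f s < \<infinity>"
    and convex: "\<And>s t a. 0 \<le> s \<Longrightarrow> 0 \<le> t \<Longrightarrow> a \<in> {0..1} \<Longrightarrow>
      f ((1 - a) * s + a * t) \<le> ennreal (1 - a) * f s + ennreal a * f t"
  shows "convex_on {0..} (\<lambda>s. enn2real (f s))"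
proof (rule convex_onI)
  fix a s t :: real
  assume a: "0 < a" "a < 1" and st: "s \<in> {0..}" "t \<in> {0..}"
  have "ennreal (enn2real (f ((1 - a) * s + a * t))) \<le>
      ennreal (1 - a) * ennreal (enn2real (f s)) + ennreal a * ennreal (enn2real (f t))"
    using convex[of s t a] a st fin by simp
  also have "\<dots> = ennreal ((1 - a) * enn2real (f s) + a * enn2real (f t))"
    using a by (simp add: ennreal_mult' ennreal_plus)
  finally show "enn2real (f ((1 - a) *\<^sub>R s + a *\<^sub>R t)) \<le> (1 - a) * enn2real (f s) + a * enn2real (f t)"
    using a by (subst (asm) ennreal_le_iff) auto
qed simp

text \<open>Off a null set \<open>N\<close> a \<open>Phi_function\<close> with Delta2 is finite; on \<open>N\<close> it is replaced by the self-dual \<open>s\<^sup>2 / 2\<close>.\<close>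

definition real_version :: "'a set \<Rightarrow> ('a \<Rightarrow> real \<Rightarrow> ennreal) \<Rightarrow> 'a \<Rightarrow> real \<Rightarrow> real" where
  "real_version N M x s = (if x \<in> N then s\<^sup>2 / 2 else enn2real (M x s))"

lemma Delta2_integrand_real_version:
  assumes \<Omega>: "\<Omega> \<in> sets lebesgue" and Phi: "Phi_function \<Omega> M"
    and N: "N \<in> null_sets (lebesgue_on \<Omega>)"
    and k: "0 < k" and h: "integrable (lebesgue_on \<Omega>) h" "\<And>x. x \<in> \<Omega> \<Longrightarrow> 0 \<le> h x"
    and Delta2: "\<And>x t. x \<in> \<Omega> - N \<Longrightarrow> 0 \<le> t \<Longrightarrow> M x (2 * t) \<le> ennreal k * M x t + ennreal (h x)"
  shows "Delta2_integrand (lebesgue_on \<Omega>) (real_version N M)"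
    and "\<And>x s. x \<in> \<Omega> - N \<Longrightarrow> 0 \<le> s \<Longrightarrow> M x s = ennreal (real_version N M x s)"
proof -
  have fin: "M x s < \<infinity>" if "x \<in> \<Omega> - N" "0 \<le> s" for x s
    using that Phi_function_finite[OF Phi _ Delta2] by blast
  show eq: "M x s = ennreal (real_version N M x s)" if "x \<in> \<Omega> - N" "0 \<le> s" for x s
    using fin[OF that] that by (simp add: real_version_def)
  have phi: "phi_function \<Omega> M" using Phi by (simp add: Phi_function_def)
  interpret sigma_finite_measure "lebesgue_on \<Omega>"
    by (intro sigma_finite_measure_restrict_space \<Omega> sigma_finite_completion sigma_finite_lborel)
  show "Delta2_integrand (lebesgue_on \<Omega>) (real_version N M)"
  proof (unfold_locales, goal_cases)
    case (1 s)
    have "N \<in> sets (lebesgue_on \<Omega>)" using N by auto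
    moreover have "(\<lambda>x. M x s) \<in> borel_measurable (lebesgue_on \<Omega>)"
      using phi 1 by (simp add: phi_function_def)
    ultimately show ?case unfolding real_version_def by measurable
  next
    case (2 x)
    show ?case
    proof (cases "x \<in> N")
      case True
      have "convex_on {0..} (\<lambda>s::real. s\<^sup>2 / 2)"
        by (rule convex_on_cdiv) (auto intro: convex_on_subset[OF convex_power2])
      then show ?thesis using True by (simp add: real_version_def[abs_def])
    next
      case False
      then show ?thesis
        using convex_on_enn2real[of "M x"] fin[of x] phi 2
        by (simp add: real_version_def[abs_def] phi_function_def)
    qed
  next
    case (3 x)
    then show ?case using phi by (auto simp: real_version_def phi_function_def)
  next
    case (4 x s)
    then show ?case using phi fin[of x s]
      by (auto simp: real_version_def phi_function_def enn2real_positive_iff less_top)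
  next
    case 5
    \<comment> \<open>On \<open>N\<close> the square satisfies the doubling condition with constant
      4, elsewhere \<open>k\<close> serves; the maximum covers both.\<close>
    have "real_version N M x (2 * s) \<le> max k 4 * real_version N M x s + h x"
      if x: "x \<in> \<Omega>" and s: "0 \<le> s" for x s
    proof (cases "x \<in> N")
      case True
      have "4 * (s\<^sup>2 / 2) \<le> max k 4 * (s\<^sup>2 / 2)" by (intro mult_right_mono) auto
      then show ?thesis using True h(2)[OF x] by (simp add: real_version_def power2_eq_square)
    next
      case False
      have nonneg: "0 \<le> real_version N M x s" using False by (simp add: real_version_def)
      have "ennreal (real_version N M x (2 * s)) \<le>
          ennreal k * ennreal (real_version N M x s) + ennreal (h x)"
        using Delta2[of x s] eq[of x s] eq[of x "2 * s"] False x s by simp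
      also have "\<dots> = ennreal (k * real_version N M x s + h x)"
        using k h(2)[OF x] nonneg by (simp add: ennreal_mult' ennreal_plus)
      finally have "real_version N M x (2 * s) \<le> k * real_version N M x s + h x"
        using k h(2)[OF x] nonneg by (subst (asm) ennreal_le_iff) auto
      also have "\<dots> \<le> max k 4 * real_version N M x s + h x"
        using nonneg by (intro add_mono mult_right_mono) auto
      finally show ?thesis .
    qed
    then show ?case
      using h(1) by (intro exI[of _ "max k 4"] conjI exI[of _ h]) auto
  qed
qed

text \<open>A single null set is taken for both Delta2 conditions, so that the two functions are
  altered at the same points and remain conjugate to each other at every point.\<close>

lemma complementary_integrands_exist:
  assumes \<Omega>: "\<Omega> \<in> sets lebesgue"
    and Phi: "Phi_function \<Omega> M" "Phi_function \<Omega> (complementary M)"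
    and D: "Delta2 \<Omega> M" "Delta2 \<Omega> (complementary M)"
  obtains \<Phi> \<Psi> where "complementary_integrands (lebesgue_on \<Omega>) \<Phi> \<Psi>"
    and "AE x in lebesgue_on \<Omega>. \<forall>s\<ge>0. M x s = ennreal (\<Phi> x s)"
proof -
  let ?C = "complementary M"
  obtain k h where k: "0 < k" "integrable (lebesgue_on \<Omega>) h" "\<And>x. x \<in> \<Omega> \<Longrightarrow> 0 \<le> h x"
    "AE x in lebesgue_on \<Omega>. \<forall>t\<ge>0. M x (2 * t) \<le> ennreal k * M x t + ennreal (h x)"
    using D(1) unfolding Delta2_def by blast
  obtain k' h' where k': "0 < k'" "integrable (lebesgue_on \<Omega>) h'" "\<And>x. x \<in> \<Omega> \<Longrightarrow> 0 \<le> h' x"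
    "AE x in lebesgue_on \<Omega>. \<forall>t\<ge>0. ?C x (2 * t) \<le> ennreal k' * ?C x t + ennreal (h' x)"
    using D(2) unfolding Delta2_def by blast
  have "AE x in lebesgue_on \<Omega>. (\<forall>t\<ge>0. M x (2 * t) \<le> ennreal k * M x t + ennreal (h x)) \<and>
      (\<forall>t\<ge>0. ?C x (2 * t) \<le> ennreal k' * ?C x t + ennreal (h' x))"
    using k(4) k'(4) by eventually_elim blast
  then obtain N where N: "N \<in> null_sets (lebesgue_on \<Omega>)"
    and good: "\<And>x. x \<in> space (lebesgue_on \<Omega>) - N \<Longrightarrow>
      (\<forall>t\<ge>0. M x (2 * t) \<le> ennreal k * M x t + ennreal (h x)) \<and>
      (\<forall>t\<ge>0. ?C x (2 * t) \<le> ennreal k' * ?C x t + ennreal (h' x))"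
    by (rule AE_E3) blast
  define \<Phi> \<Psi> where "\<Phi> = real_version N M" and "\<Psi> = real_version N ?C"
  have P: "Delta2_integrand (lebesgue_on \<Omega>) \<Phi>"
    "\<And>x s. x \<in> \<Omega> - N \<Longrightarrow> 0 \<le> s \<Longrightarrow> M x s = ennreal (\<Phi> x s)"
    unfolding \<Phi>_def using good
    by (auto intro!: Delta2_integrand_real_version[OF \<Omega> Phi(1) N k(1-3)])
  have Q: "Delta2_integrand (lebesgue_on \<Omega>) \<Psi>"
    "\<And>x s. x \<in> \<Omega> - N \<Longrightarrow> 0 \<le> s \<Longrightarrow> ?C x s = ennreal (\<Psi> x s)"
    unfolding \<Psi>_def using good
    by (auto intro!: Delta2_integrand_real_version[OF \<Omega> Phi(2) N k'(1-3)])
  interpret P: Delta2_integrand "lebesgue_on \<Omega>" \<Phi> by (rule P(1))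
  interpret Q: Delta2_integrand "lebesgue_on \<Omega>" \<Psi> by (rule Q(1))
  have pair: "\<And>s. 0 \<le> s \<Longrightarrow> s * t \<le> \<Phi> x s + \<Psi> x t" "\<And>r. r < \<Psi> x t \<Longrightarrow> \<exists>s\<ge>0. r < s * t - \<Phi> x s"
    if "x \<in> \<Omega> - N" "0 \<le> t" for x t
    using complementary_real[of M x "\<Phi> x" t "\<Psi> x t"] P(2)[of x] Q(2)[of x t] that
      P.\<Phi>_nonneg[of x] P.\<Phi>_zero[of x] Q.\<Phi>_nonneg[of x t] by auto
  have square: "\<Phi> x s = s\<^sup>2 / 2" "\<Psi> x s = s\<^sup>2 / 2" if "x \<in> N" for x s
    using that by (simp_all add: \<Phi>_def \<Psi>_def real_version_def)
  have "complementary_integrands (lebesgue_on \<Omega>) \<Phi> \<Psi>"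
  proof (unfold_locales, goal_cases)
    case (1 x s t)
    show ?case
    proof (cases "x \<in> N")
      case True
      then show ?thesis using sum_squares_bound[of s t] by (simp add: square)
    next
      case False
      then show ?thesis using pair(1)[of x t s] 1 by auto
    qed
  next
    case (2 x t r)
    show ?case
    proof (cases "x \<in> N")
      case True
      \<comment> \<open>For the square the supremum is attained at \<open>s = t\<close>.\<close>
      then show ?thesis using 2 by (intro exI[of _ t]) (simp add: square power2_eq_square)
    next
      case False
      then show ?thesis using pair(2)[of x t r] 2 by auto
    qed
  next
    case (3 x s r)
    show ?case
    proof (cases "x \<in> N")
      case True
      then show ?thesis using 3 by (intro exI[of _ s]) (simp add: square power2_eq_square)
    next
      case False
      \<comment> \<open>Only \<open>\<Psi>\<close> arises as a supremum by definition; that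
        \<open>\<Phi>\<close> is in turn the conjugate of \<open>\<Psi>\<close> uses
        convexity.\<close>
      show ?thesis
      proof (rule biconjugate_real[OF P.convex_\<Phi>])
        show "\<exists>s\<ge>0. r < s * t - \<Phi> x s" if "0 \<le> t" "r < \<Psi> x t" for t r
          using pair(2)[of x t r] that False 3 by auto
      qed (use 3 P.\<Phi>_nonneg[of x] P.\<Phi>_zero[of x] in auto)
    qed
  qed
  moreover have "AE x in lebesgue_on \<Omega>. \<forall>s\<ge>0. M x s = ennreal (\<Phi> x s)"
    using AE_not_in[OF N] AE_space by eventually_elim (use P(2) in auto)
  ultimately show thesis using that by blast
qed

section \<open>Reflexivity\<close>

theorem theorem1p4:
  fixes \<Omega> :: "(real ^ 'n) set"
    and M :: "real ^ 'n \<Rightarrow> real \<Rightarrow> ennreal"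
  assumes "open \<Omega>"
    and "Phi_function \<Omega> M"
    and "Phi_function \<Omega> (complementary M)"
    and "locally_integrable \<Omega> M"
    and "locally_integrable \<Omega> (complementary M)"
    and "Delta2 \<Omega> M"
    and "Delta2 \<Omega> (complementary M)"
  shows "reflexive_space (MO_space \<Omega> M)"
proof -
  have \<Omega>: "\<Omega> \<in> sets lebesgue"
    using assms(1) by (intro sets_completionI_sets) simp
  obtain \<Phi> \<Psi> where "complementary_integrands (lebesgue_on \<Omega>) \<Phi> \<Psi>"
    and "AE x in lebesgue_on \<Omega>. \<forall>s\<ge>0. M x s = ennreal (\<Phi> x s)"
    using complementary_integrands_exist[OF \<Omega> assms(2,3,6,7)] .
  then interpret MO_complementary \<Omega> \<Phi> \<Psi> M
    by (intro MO_complementary.intro MO_complementary_axioms.intro)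
  show ?thesis by (rule reflexive_X)
qed

end
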